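(* Let $H$ be a closed subgroup of a locally compact group $G$ such that $G/H$ carries a $G$-invariant probability measure. Let $\alpha(g)v=\pi(g)v+b(g)$ be an affine isometric action of $G$ on a Hilbert space $\mathcal H$, with linear part $\pi$ and 1-cocycle $b\in Z^1(G,\pi)$. Assume either that $H$ is co-compact in $G$, or that $H$ is discrete and the cocycle $b$ is integrable on $G/H$. If $\alpha$ is irreducible, then the restriction $\alpha|_H$ is irreducible.
   Context: Here $\pi$ is a continuous unitary representation of $G$ on $\mathcal H$ and $b:G\to\mathcal H$ is continuous with $b(gh)=b(g)+\pi(g)b(h)$. An affine isometric action of a group on $\mathcal H$ is irreducible if $\mathcal H$ has no non-empty, closed, proper invariant affine subspace. For $H$ a lattice in $G$ (discrete, with $G/H$ of finite invariant measure), the cocycle $b$ is integrable on $G/H$ if there exists a measurable fundamental domain $\Omega$ for the right action of $H$ on $G$ such that $\int_\Omega\|b(g)\|\,dg<+\infty$, where $dg$ is Haar measure on $G$. *)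

theory Defs
  imports "HOL-Analysis.Analysis"
begin

(* Groups are written additively, because the library's class of topological groups is
   topological_group_add.  That class does not assume commutativity: g + h stands for the
   product gh, - g for the inverse and 0 for the neutral element. *)

(* The norm comes from the superclass real_inner: since inner is the real part of cinner,
   norm x = sqrt (Re (cinner x x)). *)
class complex_hilbert_space = real_inner + complete_space +
  fixes scaleC :: "complex \<Rightarrow> 'a \<Rightarrow> 'a"  (infixr \<open>*\<^sub>C\<close> 75)
    and cinner :: "'a \<Rightarrow> 'a \<Rightarrow> complex"
  assumes scaleC_add_right: "c *\<^sub>C (x + y) = c *\<^sub>C x + c *\<^sub>C y"
    and scaleC_add_left: "(c + d) *\<^sub>C x = c *\<^sub>C x + d *\<^sub>C x"
    and scaleC_scaleC: "c *\<^sub>C d *\<^sub>C x = (c * d) *\<^sub>C x"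
    and scaleR_scaleC: "r *\<^sub>R x = complex_of_real r *\<^sub>C x"
    and cinner_commute: "cinner x y = cnj (cinner y x)"
    and cinner_add_left: "cinner (x + y) z = cinner x z + cinner y z"
    and cinner_scaleC_left: "cinner (c *\<^sub>C x) y = c * cinner x y"
    and inner_eq_Re_cinner: "inner x y = Re (cinner x y)"

definition complex_affine :: "'h::complex_hilbert_space set \<Rightarrow> bool" where
  "complex_affine A \<longleftrightarrow>
     (\<forall>x\<in>A. \<forall>y\<in>A. \<forall>c d. c + d = 1 \<longrightarrow> c *\<^sub>C x + d *\<^sub>C y \<in> A)"

definition unitary :: "('h::complex_hilbert_space \<Rightarrow> 'h) \<Rightarrow> bool" where
  "unitary u \<longleftrightarrow>
     (\<forall>x y. u (x + y) = u x + u y) \<and> (\<forall>c x. u (c *\<^sub>C x) = c *\<^sub>C u x) \<and>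
     (\<forall>x y. cinner (u x) (u y) = cinner x y) \<and> surj u"

definition continuous_unitary_rep ::
    "('g::topological_group_add \<Rightarrow> 'h::complex_hilbert_space \<Rightarrow> 'h) \<Rightarrow> bool" where
  "continuous_unitary_rep \<pi> \<longleftrightarrow>
     (\<forall>g. unitary (\<pi> g)) \<and> \<pi> 0 = id \<and> (\<forall>g h. \<pi> (g + h) = \<pi> g \<circ> \<pi> h) \<and>
     (\<forall>v. continuous_on UNIV (\<lambda>g. \<pi> g v))"

definition continuous_cocycle ::
    "('g::topological_group_add \<Rightarrow> 'h::complex_hilbert_space \<Rightarrow> 'h) \<Rightarrow> ('g \<Rightarrow> 'h) \<Rightarrow> bool" where
  "continuous_cocycle \<pi> b \<longleftrightarrow>
     continuous_on UNIV b \<and> (\<forall>g h. b (g + h) = b g + \<pi> g (b h))"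

(* Irreducibility of the restriction of the action to the subgroup S; S = UNIV gives
   irreducibility of the action itself. *)
definition irreducible_on ::
    "'g set \<Rightarrow> ('g \<Rightarrow> 'h::complex_hilbert_space \<Rightarrow> 'h) \<Rightarrow> bool" where
  "irreducible_on S \<alpha> \<longleftrightarrow>
     \<not> (\<exists>A. A \<noteq> {} \<and> A \<noteq> UNIV \<and> closed A \<and> complex_affine A \<and> (\<forall>g\<in>S. \<alpha> g ` A \<subseteq> A))"

definition add_subgroup :: "'g::group_add set \<Rightarrow> bool" where
  "add_subgroup H \<longleftrightarrow> 0 \<in> H \<and> (\<forall>x\<in>H. \<forall>y\<in>H. x + y \<in> H) \<and> (\<forall>x\<in>H. - x \<in> H)"

definition left_coset :: "'g::group_add set \<Rightarrow> 'g \<Rightarrow> 'g set" where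
  "left_coset H g = (\<lambda>h. g + h) ` H"

(* The quotient topology on the space of left cosets. *)
definition coset_topology :: "'g::topological_group_add set \<Rightarrow> 'g set topology" where
  "coset_topology H =
     topology (\<lambda>U. U \<subseteq> range (left_coset H) \<and> open (left_coset H -` U))"

lemma openin_coset_topology:
  "openin (coset_topology H) U \<longleftrightarrow>
     U \<subseteq> range (left_coset H) \<and> open (left_coset H -` U)"
proof -
  have "istopology (\<lambda>U. U \<subseteq> range (left_coset H) \<and> open (left_coset H -` U))"
    unfolding istopology_def
  proof (intro conjI allI impI)
    fix \<K> assume K: "\<forall>K\<in>\<K>. K \<subseteq> range (left_coset H) \<and> open (left_coset H -` K)"
    then show "\<Union>\<K> \<subseteq> range (left_coset H)" by blast
    from K show "open (left_coset H -` \<Union>\<K>)"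
      unfolding vimage_Union by (intro open_UN) blast
  qed (blast, simp add: vimage_Int open_Int)
  then show ?thesis
    unfolding coset_topology_def by (simp add: topology_inverse')
qed

lemma topspace_coset_topology: "topspace (coset_topology H) = range (left_coset H)"
proof -
  have "openin (coset_topology H) (range (left_coset H))"
    unfolding openin_coset_topology by (simp add: vimage_def)
  then show ?thesis
    by (meson openin_coset_topology openin_subset openin_topspace subset_antisym)
qed

definition radon_measure :: "'a topology \<Rightarrow> 'a measure \<Rightarrow> bool" where
  "radon_measure T M \<longleftrightarrow>
     space M = topspace T \<and> sets M = sigma_sets (topspace T) {U. openin T U} \<and>
     (\<forall>K. compactin T K \<longrightarrow> emeasure M K < \<infinity>) \<and>
     (\<forall>A\<in>sets M. emeasure M A = (INF U\<in>{U. openin T U \<and> A \<subseteq> U}. emeasure M U)) \<and>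
     (\<forall>U. openin T U \<longrightarrow> emeasure M U = (SUP K\<in>{K. compactin T K \<and> K \<subseteq> U}. emeasure M K))"

definition haar_measure :: "'g::topological_group_add measure \<Rightarrow> bool" where
  "haar_measure \<mu> \<longleftrightarrow>
     radon_measure euclidean \<mu> \<and> emeasure \<mu> UNIV \<noteq> 0 \<and>
     (\<forall>g. \<forall>A\<in>sets \<mu>. emeasure \<mu> ((\<lambda>x. g + x) ` A) = emeasure \<mu> A)"

definition invariant_probability_on_cosets ::
    "'g::topological_group_add set \<Rightarrow> 'g set measure \<Rightarrow> bool" where
  "invariant_probability_on_cosets H \<nu> \<longleftrightarrow>
     radon_measure (coset_topology H) \<nu> \<and> emeasure \<nu> (space \<nu>) = 1 \<and>
     (\<forall>g. \<forall>A\<in>sets \<nu>. emeasure \<nu> ((\<lambda>C. (\<lambda>x. g + x) ` C) ` A) = emeasure \<nu> A)"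

(* Every element of G is uniquely of the form xh with x in \<Omega> and h in H. *)
definition fundamental_domain :: "'g::topological_group_add set \<Rightarrow> 'g set \<Rightarrow> bool" where
  "fundamental_domain H \<Omega> \<longleftrightarrow>
     \<Omega> \<in> sets borel \<and> bij_betw (\<lambda>(x, h). x + h) (\<Omega> \<times> H) UNIV"

(* A Haar measure is unique up to a positive factor, so its choice does not matter. *)
definition integrable_on_cosets ::
    "'g::topological_group_add set \<Rightarrow> ('g \<Rightarrow> 'h::real_normed_vector) \<Rightarrow> bool" where
  "integrable_on_cosets H b \<longleftrightarrow>
     (\<exists>\<mu> \<Omega>. haar_measure \<mu> \<and> fundamental_domain H \<Omega> \<and>
        (\<integral>\<^sup>+ x\<in>\<Omega>. ennreal (norm (b x)) \<partial>\<mu>) < \<infinity>)"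

end

theory Submission
  imports Defs "HOL-Computational_Algebra.Fundamental_Theorem_Algebra"
begin

text \<open>Let \<open>A\<close> be a closed affine subspace invariant under \<open>H\<close>. The displacement from a point \<open>v\<close> to
  its projection on \<open>\<alpha> g ` A\<close> depends only on the coset of \<open>g\<close>, and it is integrable over the
  cosets under either hypothesis. Its average is an affine map \<open>c - S v\<close> with
  \<open>c - S (\<alpha> g v) = \<pi> g (c - S v)\<close>, where \<open>0 \<le> S \<le> 1\<close> is self-adjoint and commutes with \<open>\<pi>\<close>.
  If \<open>W\<close> is a closed \<open>\<pi>\<close>-invariant subspace, \<open>{v. S v - c \<in> W}\<close> is empty or everything when \<open>\<alpha>\<close> is
  irreducible. For \<open>W\<close> the spectral subspace of \<open>S\<close> belonging to \<open>[0, e]\<close> it is not empty, since \<open>S\<close> is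
  invertible on the complement; hence the range of \<open>S\<close> lies in \<open>W\<close> for all \<open>e > 0\<close>, so \<open>S = 0\<close>.
  As the invariant measure has full support, \<open>S = 0\<close> forces \<open>A\<close> to be the whole space.

  In the discrete case the integrability over the cosets is compared with that over a fundamental
  domain through an inequality between the two measures, proved by averaging over the translates of
  small sets as in the uniqueness proof for Haar measure.\<close>

section \<open>Hilbert spaces\<close>

text \<open>Why a spectral cut is needed: if \<open>S\<close> were bijective, the solution of
  \<open>S v = c\<close> would satisfy \<open>S (\<alpha> g v) = c = S v\<close>, so
  \<open>v\<close> would be a fixed point of \<alpha>, an invariant affine subspace consisting of
  one point. Nothing gives \<open>S\<close> a spectral gap at 0, so the equation is solved only
  modulo the spectral subspace for \<open>[0, e]\<close>. Polynomials in \<open>S\<close> suffice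
  for this, provided that the norm of \<open>p(S)\<close> is at most the supremum of
  \<open>p\<close> on \<open>[0, 1]\<close>; this bound is derived by splitting polynomials into
  linear factors.

  Neither the group nor the Hilbert space is assumed separable, and this shapes the rest. Averages
  of vectors are defined weakly, by the Riesz representation of an integral of real functions. Full
  support of the invariant measures comes from inner regularity instead of countable covers. The
  Haar measure and the measure on the cosets are compared only up to a constant, which is enough
  because only the finiteness of an integral has to be transferred.\<close>

lemma norm_diff_scaleR_power2:
  fixes u y :: "'a::real_inner"
  shows "(norm (u - t *\<^sub>R y))\<^sup>2 = (norm u)\<^sup>2 - 2 * t * inner u y + t\<^sup>2 * (norm y)\<^sup>2"
  unfolding power2_norm_eq_inner
  by (simp add: inner_diff_left inner_diff_right inner_commute[of y u] power2_eq_square[of t] right_diff_distrib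
      del: dot_square_norm)

text \<open>A minimizing sequence is Cauchy by the parallelogram law, since midpoints stay in
  \<open>L\<close>; orthogonality is the minimality of its limit.\<close>

lemma closed_subspace_projection_exists:
  fixes L :: "'a::{real_inner, complete_space} set"
  assumes "subspace L" "closed L"
  shows "\<exists>z\<in>L. \<forall>y\<in>L. inner (x - z) y = 0"
proof -
  define D where "D = (INF y\<in>L. (norm (x - y))\<^sup>2)"
  have L0: "0 \<in> L" using assms(1) by (rule subspace_0)
  have bdd: "bdd_below ((\<lambda>y. (norm (x - y))\<^sup>2) ` L)" by (rule bdd_belowI[of _ 0]) auto
  have D_le: "D \<le> (norm (x - y))\<^sup>2" if "y \<in> L" for y
    unfolding D_def using bdd that by (rule cINF_lower)
  have "\<exists>y\<in>L. (norm (x - y))\<^sup>2 < D + 1 / Suc n" for n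
  proof -
    have "(INF y\<in>L. (norm (x - y))\<^sup>2) < D + 1 / Suc n" unfolding D_def[symmetric] by simp
    then show ?thesis using cINF_less_iff[OF _ bdd] L0 by blast
  qed
  then obtain Y where YL: "Y n \<in> L" and Y: "(norm (x - Y n))\<^sup>2 < D + 1 / Suc n" for n by metis
  have par: "(norm (Y m - Y n))\<^sup>2 \<le> 2 / Suc m + 2 / Suc n" for m n
  proof -
    let ?w = "(1/2) *\<^sub>R (Y m + Y n)"
    have "?w \<in> L" using YL assms(1) by (simp add: subspace_add subspace_scale)
    then have "D \<le> (norm (x - ?w))\<^sup>2" by (rule D_le)
    moreover have "(norm (Y m - Y n))\<^sup>2 = 2 * (norm (x - Y m))\<^sup>2 + 2 * (norm (x - Y n))\<^sup>2 - 4 * (norm (x - ?w))\<^sup>2"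
      by (simp add: power2_norm_eq_inner inner_diff_left inner_diff_right inner_add_left
          inner_add_right inner_commute algebra_simps)
    ultimately show ?thesis using Y[of m] Y[of n] by simp
  qed
  have "Cauchy Y"
    unfolding Cauchy_altdef
  proof (intro allI impI)
    fix e :: real assume e: "e > 0"
    obtain M where M: "4 / e\<^sup>2 < real M" using reals_Archimedean2 by blast
    then have Mpos: "real M > 0" using e by (meson divide_pos_pos less_trans zero_less_numeral zero_less_power)
    have "dist (Y m) (Y n) < e" if "m \<ge> M" "n > m" for m n
    proof -
      have "2 / Suc m + 2 / Suc n \<le> 2 / real M + 2 / real M"
        using that Mpos by (intro add_mono divide_left_mono) auto
      also have "\<dots> < e\<^sup>2" using M Mpos e by (simp add: field_simps)
      finally have "(norm (Y m - Y n))\<^sup>2 < e\<^sup>2" using par[of m n] by linarith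
      then show ?thesis using e by (simp add: dist_norm power_less_imp_less_base)
    qed
    then show "\<exists>M. \<forall>m\<ge>M. \<forall>n>m. dist (Y m) (Y n) < e" by blast
  qed
  then obtain z where z: "Y \<longlonglongrightarrow> z" using Cauchy_convergent convergent_def by blast
  have zL: "z \<in> L" using closed_sequentially[OF assms(2) _ z] YL by blast
  have "(\<lambda>n. (norm (x - Y n))\<^sup>2) \<longlonglongrightarrow> (norm (x - z))\<^sup>2" by (intro tendsto_intros z)
  moreover have "(\<lambda>n. D + 1 / real (Suc n)) \<longlonglongrightarrow> D + 0"
    by (intro tendsto_intros LIMSEQ_Suc lim_1_over_n)
  ultimately have zD: "(norm (x - z))\<^sup>2 \<le> D"
    by (intro LIMSEQ_le[where Y = "\<lambda>n. D + 1 / real (Suc n)"]) (use Y less_imp_le in auto)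
  have "inner (x - z) y = 0" if y: "y \<in> L" for y
  proof (cases "y = 0")
    case False
    \<comment> \<open>The minimizer of the quadratic function \<open>norm (x - z - t y)^2\<close> of
      \<open>t\<close>.\<close>
    define t where "t = inner (x - z) y / (norm y)\<^sup>2"
    have "z + t *\<^sub>R y \<in> L" using zL y assms(1) by (simp add: subspace_add subspace_scale)
    then have "D \<le> (norm (x - (z + t *\<^sub>R y)))\<^sup>2" by (rule D_le)
    also have "\<dots> = (norm ((x - z) - t *\<^sub>R y))\<^sup>2" by (simp only: diff_diff_add)
    also have "\<dots> = (norm (x - z))\<^sup>2 - 2 * t * inner (x - z) y + t\<^sup>2 * (norm y)\<^sup>2"
      by (rule norm_diff_scaleR_power2)
    also have "t\<^sup>2 * (norm y)\<^sup>2 = t * inner (x - z) y"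
      using False by (simp add: t_def power2_eq_square)
    finally have "t * inner (x - z) y \<le> 0" using zD by linarith
    then have "(inner (x - z) y)\<^sup>2 / (norm y)\<^sup>2 \<le> 0" by (simp add: t_def power2_eq_square)
    then show ?thesis using False by (simp add: divide_le_0_iff)
  qed simp
  then show ?thesis using zL by blast
qed

text \<open>The orthogonal complement of the kernel of a non-zero \<open>f\<close> is a line;
  \<open>x - z\<close> spans it and only has to be rescaled.\<close>

lemma Riesz_representation_exists:
  fixes f :: "'a::{real_inner, complete_space} \<Rightarrow> real"
  assumes "bounded_linear f"
  shows "\<exists>z. \<forall>y. f y = inner y z"
proof (cases "\<forall>y. f y = 0")
  case True
  then show ?thesis by (intro exI[of _ 0]) simp
next
  case False
  then obtain x where x: "f x \<noteq> 0" by blast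
  interpret f: bounded_linear f by fact
  let ?K = "{y. f y = 0}"
  have "subspace ?K" by (auto simp: subspace_def f.zero f.add f.scaleR)
  moreover have "closed ?K"
    by (intro closed_Collect_eq continuous_on_const linear_continuous_on assms)
  ultimately obtain z where zK: "f z = 0" and z: "\<And>y. f y = 0 \<Longrightarrow> inner (x - z) y = 0"
    using closed_subspace_projection_exists[of ?K x] by blast
  let ?u = "x - z"
  have fu: "f ?u = f x" using zK by (simp add: f.diff)
  then have unz: "?u \<noteq> 0" using x f.zero by auto
  have "f y = inner y ((f x / (norm ?u)\<^sup>2) *\<^sub>R ?u)" for y
  proof -
    have "f (y - (f y / f x) *\<^sub>R ?u) = 0" using x fu by (simp add: f.diff f.scaleR)
    then have "inner ?u (y - (f y / f x) *\<^sub>R ?u) = 0" by (rule z)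
    then have "inner y ?u = (f y / f x) * (norm ?u)\<^sup>2"
      by (simp add: inner_diff_right power2_norm_eq_inner inner_commute)
    then show ?thesis using x unz by simp
  qed
  then show ?thesis by blast
qed

lemma inner_eq_all_imp_eq:
  fixes x y :: "'a::real_inner"
  assumes "\<And>z. inner z x = inner z y"
  shows "x = y"
proof -
  have "inner (x - y) (x - y) = 0" using assms[of "x - y"] by (simp add: inner_diff_right)
  then show ?thesis by simp
qed

section \<open>Complex scalars and the real inner product\<close>

lemma scaleC_one [simp]: "1 *\<^sub>C x = x" for x :: "'h::complex_hilbert_space"
  using scaleR_scaleC[of 1 x] by simp

lemma scaleC_zero_left [simp]: "0 *\<^sub>C x = 0" for x :: "'h::complex_hilbert_space"
  using scaleR_scaleC[of 0 x] by simp

lemma scaleC_zero_right [simp]: "c *\<^sub>C 0 = 0" for c :: complex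
  using scaleC_add_right[of c 0 "0::'h::complex_hilbert_space"] by simp

lemma scaleC_minus_left: "(- c) *\<^sub>C x = - (c *\<^sub>C x)" for x :: "'h::complex_hilbert_space"
  using scaleC_add_left[of c "- c" x] by (simp add: eq_neg_iff_add_eq_0 add.commute)

lemma scaleC_minus_right: "c *\<^sub>C (- x) = - (c *\<^sub>C x)" for x :: "'h::complex_hilbert_space"
  using scaleC_add_right[of c x "- x"] by (simp add: eq_neg_iff_add_eq_0 add.commute)

lemma scaleC_diff_left: "(c - d) *\<^sub>C x = c *\<^sub>C x - d *\<^sub>C x" for x :: "'h::complex_hilbert_space"
  using scaleC_add_left[of c "- d" x] by (simp add: scaleC_minus_left)

lemma scaleC_diff_right: "c *\<^sub>C (x - y) = c *\<^sub>C x - c *\<^sub>C y" for x :: "'h::complex_hilbert_space"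
  using scaleC_add_right[of c x "- y"] by (simp add: scaleC_minus_right)

lemma inner_scaleC: "inner (c *\<^sub>C x) (c *\<^sub>C y) = (cmod c)\<^sup>2 * inner x y"
  for x :: "'h::complex_hilbert_space"
proof -
  have "cinner (c *\<^sub>C x) (c *\<^sub>C y) = c * cnj (cinner (c *\<^sub>C y) x)"
    by (metis cinner_commute cinner_scaleC_left)
  also have "\<dots> = c * cnj c * cinner x y"
    by (metis cinner_commute cinner_scaleC_left complex_cnj_mult mult.assoc)
  finally show ?thesis
    by (simp add: inner_eq_Re_cinner complex_norm_square[symmetric] del: of_real_power)
qed

lemma inner_scaleC_left: "inner (c *\<^sub>C x) y = inner x (cnj c *\<^sub>C y)"
  for x :: "'h::complex_hilbert_space"
proof -
  have "cinner x (cnj c *\<^sub>C y) = cnj (cnj c * cinner y x)"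
    by (metis cinner_commute cinner_scaleC_left)
  also have "\<dots> = c * cinner x y" by (simp add: cinner_commute[of x y])
  finally show ?thesis by (simp add: inner_eq_Re_cinner cinner_scaleC_left)
qed

lemma norm_scaleC: "norm (c *\<^sub>C x) = cmod c * norm x" for x :: "'h::complex_hilbert_space"
  by (simp add: norm_eq_sqrt_inner inner_scaleC real_sqrt_mult)

lemma inner_i_self: "inner x (\<i> *\<^sub>C x) = 0" for x :: "'h::complex_hilbert_space"
proof -
  have "inner (\<i> *\<^sub>C x) x = - inner x (\<i> *\<^sub>C x)"
    by (simp add: inner_scaleC_left scaleC_minus_left)
  then show ?thesis by (simp add: inner_commute)
qed

lemma scaleC_eq_Re_Im: "c *\<^sub>C x = Re c *\<^sub>R x + Im c *\<^sub>R (\<i> *\<^sub>C x)"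
  for x :: "'h::complex_hilbert_space"
proof -
  have "c = complex_of_real (Re c) + complex_of_real (Im c) * \<i>"
    using complex_eq[of c] by (simp add: mult.commute)
  then have "c *\<^sub>C x = complex_of_real (Re c) *\<^sub>C x + complex_of_real (Im c) *\<^sub>C \<i> *\<^sub>C x"
    by (metis scaleC_add_left scaleC_scaleC)
  then show ?thesis by (simp add: scaleR_scaleC)
qed

lemma bounded_linear_scaleC: "bounded_linear (\<lambda>x::'h::complex_hilbert_space. c *\<^sub>C x)"
proof (rule bounded_linear_intro[where K = "cmod c"])
  show "c *\<^sub>C r *\<^sub>R x = r *\<^sub>R c *\<^sub>C x" for r and x :: 'h
    by (simp add: scaleR_scaleC scaleC_scaleC mult.commute)
qed (simp_all add: scaleC_add_right norm_scaleC mult.commute)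

definition complex_subspace :: "'h::complex_hilbert_space set \<Rightarrow> bool" where
  "complex_subspace L \<longleftrightarrow> 0 \<in> L \<and> (\<forall>x\<in>L. \<forall>y\<in>L. x + y \<in> L) \<and> (\<forall>c. \<forall>x\<in>L. c *\<^sub>C x \<in> L)"

lemma complex_subspace_imp_subspace: "complex_subspace L \<Longrightarrow> subspace L"
  by (simp add: complex_subspace_def subspace_def scaleR_scaleC)

text \<open>Dilations about \<open>a\<close> are affine combinations with \<open>a\<close>; a sum is
  obtained by doubling the midpoint about \<open>a\<close>.\<close>

lemma complex_affine_translate:
  assumes "complex_affine A" "a \<in> A"
  shows "complex_subspace ((\<lambda>x. x - a) ` A)"
proof -
  have scal: "c *\<^sub>C (x - a) + a \<in> A" if "x \<in> A" for c x
  proof -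
    have "c *\<^sub>C x + (1 - c) *\<^sub>C a \<in> A"
      using assms that unfolding complex_affine_def by (metis add_diff_cancel_left' diff_add_cancel)
    then show ?thesis by (simp add: scaleC_diff_left scaleC_diff_right algebra_simps)
  qed
  have addA: "x + y - a \<in> A" if "x \<in> A" "y \<in> A" for x y
  proof -
    have "(1/2) *\<^sub>C x + (1/2) *\<^sub>C y \<in> A" using assms that unfolding complex_affine_def by simp
    then have "2 *\<^sub>C ((1/2) *\<^sub>C x + (1/2) *\<^sub>C y - a) + a \<in> A" by (rule scal)
    moreover have "2 *\<^sub>C a = a + a" using scaleC_add_left[of 1 1 a] by simp
    ultimately show ?thesis by (simp add: scaleC_diff_right scaleC_add_right scaleC_scaleC algebra_simps)
  qed
  show ?thesis
    unfolding complex_subspace_def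
  proof (intro conjI ballI allI)
    show "0 \<in> (\<lambda>x. x - a) ` A" using assms(2) by force
    show "x + y \<in> (\<lambda>x. x - a) ` A" if "x \<in> (\<lambda>x. x - a) ` A" "y \<in> (\<lambda>x. x - a) ` A" for x y
    proof -
      from that obtain x' y' where "x' \<in> A" "x = x' - a" "y' \<in> A" "y = y' - a" by auto
      then show ?thesis using addA[of x' y'] by (intro image_eqI[of _ _ "x' + y' - a"]) auto
    qed
    show "c *\<^sub>C x \<in> (\<lambda>x. x - a) ` A" if "x \<in> (\<lambda>x. x - a) ` A" for c x
    proof -
      from that obtain x' where "x' \<in> A" "x = x' - a" by auto
      then show ?thesis using scal[of x' c] by (intro image_eqI[of _ _ "c *\<^sub>C (x' - a) + a"]) auto
    qed
  qed
qed

text \<open>Each identity for \<open>Q\<close> is checked by showing that the proposed value has the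
  two properties that determine \<open>Q x\<close>. Complex homogeneity holds although orthogonality
  is only real, because \<open>L\<close> is stable under multiplication by
  \<open>cnj c\<close>.\<close>

lemma complement_projection_exists:
  fixes L :: "'h::complex_hilbert_space set"
  assumes L: "complex_subspace L" "closed L"
  obtains Q where "bounded_linear Q" "\<And>c x. Q (c *\<^sub>C x) = c *\<^sub>C Q x"
    "\<And>x y. inner (Q x) y = inner (Q x) (Q y)" "\<And>x. norm (Q x) \<le> norm x"
    "\<And>x. Q x = 0 \<longleftrightarrow> x \<in> L"
    "\<And>x z. x - z \<in> L \<Longrightarrow> (\<And>y. y \<in> L \<Longrightarrow> inner z y = 0) \<Longrightarrow> Q x = z"
    "\<And>x. x - Q x \<in> L" "\<And>x y. y \<in> L \<Longrightarrow> inner (Q x) y = 0"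
proof -
  have sub: "subspace L" by (rule complex_subspace_imp_subspace[OF L(1)])
  have L_scaleC: "c *\<^sub>C x \<in> L" if "x \<in> L" for c x
    using L(1) that unfolding complex_subspace_def by blast
  have "\<exists>q. x - q \<in> L \<and> (\<forall>y\<in>L. inner q y = 0)" for x
  proof -
    obtain z where z: "z \<in> L" "\<forall>y\<in>L. inner (x - z) y = 0"
      using closed_subspace_projection_exists[OF sub L(2)] by blast
    then show ?thesis by (intro exI[of _ "x - z"]) simp
  qed
  then obtain Q where Q: "\<And>x. x - Q x \<in> L" and Q0: "\<And>x y. y \<in> L \<Longrightarrow> inner (Q x) y = 0" by metis
  have eqI: "Q x = z" if xz: "x - z \<in> L" and z: "\<And>y. y \<in> L \<Longrightarrow> inner z y = 0" for x z
  proof -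
    have "Q x - z = (x - z) - (x - Q x)" by simp
    then have "Q x - z \<in> L" using subspace_diff[OF sub xz Q[of x]] by simp
    then have "inner (Q x - z) (Q x - z) = 0"
      by (simp add: inner_diff_left[of "Q x"] Q0 z)
    then show ?thesis by simp
  qed
  have add: "Q (x + y) = Q x + Q y" for x y
  proof (rule eqI)
    have "x + y - (Q x + Q y) = (x - Q x) + (y - Q y)" by simp
    then show "x + y - (Q x + Q y) \<in> L" by (simp only: subspace_add[OF sub Q[of x] Q[of y]])
  qed (simp add: inner_add_left Q0)
  have scaleC: "Q (c *\<^sub>C x) = c *\<^sub>C Q x" for c x
  proof (rule eqI)
    show "c *\<^sub>C x - c *\<^sub>C Q x \<in> L"
      unfolding scaleC_diff_right[symmetric] by (rule L_scaleC[OF Q])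
    show "inner (c *\<^sub>C Q x) y = 0" if "y \<in> L" for y
      unfolding inner_scaleC_left by (rule Q0[OF L_scaleC[OF that]])
  qed
  have sym: "inner (Q x) y = inner (Q x) (Q y)" for x y
    using Q0[OF Q[of y], of x] by (simp add: inner_diff_right)
  have norm_le: "norm (Q x) \<le> norm x" for x
  proof -
    have "norm (Q x) * norm (Q x) = inner (Q x) x"
      by (simp add: sym[of x x] power2_norm_eq_inner[symmetric] power2_eq_square)
    also have "\<dots> \<le> norm (Q x) * norm x" by (rule norm_cauchy_schwarz)
    finally show ?thesis by (cases "Q x = 0") simp_all
  qed
  have bl: "bounded_linear Q"
    by (rule bounded_linear_intro[where K = 1]) (simp_all add: add scaleR_scaleC scaleC norm_le)
  have zero: "Q x = 0 \<longleftrightarrow> x \<in> L" for x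
    using Q[of x] eqI[of x 0] by auto
  show ?thesis by (rule that[of Q]) (fact bl scaleC sym norm_le zero eqI Q Q0)+
qed

section \<open>Spectral subspaces of a positive contraction\<close>

text \<open>The operator \<open>p(S)\<close> by Horner's scheme. Complex coefficients allow
  splitting into linear factors; \<open>real_coeffs\<close> records when \<open>p(S)\<close> is
  self-adjoint.\<close>

definition poly_op :: "('h::complex_hilbert_space \<Rightarrow> 'h) \<Rightarrow> complex poly \<Rightarrow> 'h \<Rightarrow> 'h" where
  "poly_op S p = fold_coeffs (\<lambda>a f x. a *\<^sub>C x + S (f x)) p (\<lambda>x. 0)"

definition real_coeffs :: "complex poly \<Rightarrow> bool" where
  "real_coeffs p \<longleftrightarrow> (\<forall>i. coeff p i \<in> \<real>)"

lemma real_coeffs_pCons: "real_coeffs (pCons a p) \<longleftrightarrow> a \<in> \<real> \<and> real_coeffs p"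
  unfolding real_coeffs_def
  by (metis coeff_pCons_0 coeff_pCons_Suc not0_implies_Suc)

lemma real_coeffs_0 [simp]: "real_coeffs 0" by (simp add: real_coeffs_def)

lemma real_coeffs_diff: "real_coeffs p \<Longrightarrow> real_coeffs q \<Longrightarrow> real_coeffs (p - q)"
  by (simp add: real_coeffs_def Reals_diff)

lemma real_coeffs_mult: "real_coeffs p \<Longrightarrow> real_coeffs q \<Longrightarrow> real_coeffs (p * q)"
  by (simp add: real_coeffs_def coeff_mult sum_in_Reals Reals_mult)

lemma real_coeffs_approximation:
  fixes f :: "real \<Rightarrow> real"
  assumes "continuous_on {0..1} f" "e > 0"
  obtains p where "real_coeffs p"
    "\<And>s. s \<in> {0..1} \<Longrightarrow> cmod (poly p (of_real s) - of_real (f s)) \<le> e"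
proof -
  obtain g where g: "real_polynomial_function g" and fg: "\<And>s. s \<in> {0..1} \<Longrightarrow> \<bar>f s - g s\<bar> < e"
    using Stone_Weierstrass_real_polynomial_function[OF compact_Icc assms] by blast
  obtain a n where ga: "g = (\<lambda>x. \<Sum>i\<le>n. a i * x ^ i)"
    using g real_polynomial_function_iff_sum by blast
  define p where "p = (\<Sum>i\<le>n. monom (complex_of_real (a i)) i)"
  have pg: "poly p (of_real s) = of_real (g s)" for s
    by (simp add: p_def ga poly_sum poly_monom)
  have "real_coeffs p"
    unfolding real_coeffs_def p_def coeff_sum by (auto intro!: sum_in_Reals)
  moreover have "cmod (poly p (of_real s) - of_real (f s)) \<le> e" if "s \<in> {0..1}" for s
    using fg[OF that] unfolding pg of_real_diff[symmetric] norm_of_real by simp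
  ultimately show ?thesis by (rule that)
qed

text \<open>The condition \<open>0 <= S <= 1\<close> by quadratic forms. Together with
  \<open>S_scaleC\<close>, the real symmetry \<open>S_sym\<close> amounts to complex
  self-adjointness.\<close>

locale positive_contraction =
  fixes S :: "'h::complex_hilbert_space \<Rightarrow> 'h"
  assumes bounded_linear_S: "bounded_linear S"
    and S_scaleC: "S (c *\<^sub>C x) = c *\<^sub>C S x"
    and S_sym: "inner (S x) y = inner x (S y)"
    and S_nonneg: "0 \<le> inner (S x) x"
    and S_le: "inner (S x) x \<le> (norm x)\<^sup>2"
begin

sublocale S: bounded_linear S by (rule bounded_linear_S)

lemma poly_op_0 [simp]: "poly_op S 0 x = 0"
  by (simp add: poly_op_def)

lemma poly_op_pCons: "poly_op S (pCons a p) x = a *\<^sub>C x + S (poly_op S p x)"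
  by (cases "p = 0 \<and> a = 0") (auto simp: poly_op_def S.zero)

lemma bounded_linear_poly_op: "bounded_linear (poly_op S p)"
proof (induction p)
  case 0
  then show ?case by (simp add: bounded_linear_zero)
next
  case (pCons a p)
  have "bounded_linear (\<lambda>x. a *\<^sub>C x + S (poly_op S p x))"
    by (intro bounded_linear_add bounded_linear_scaleC
        bounded_linear_compose[OF bounded_linear_S] pCons.IH)
  then show ?case by (simp add: poly_op_pCons[abs_def])
qed

lemma poly_op_smult: "poly_op S (smult c p) x = c *\<^sub>C poly_op S p x"
  by (induction p) (simp_all add: poly_op_pCons scaleC_add_right scaleC_scaleC S_scaleC)

lemma poly_op_add: "poly_op S (p + q) x = poly_op S p x + poly_op S q x"
proof (induction p arbitrary: q)
  case (pCons a p)
  then show ?case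
    by (cases q) (simp add: poly_op_pCons scaleC_add_left S.add algebra_simps)
qed simp

lemma poly_op_diff: "poly_op S (p - q) x = poly_op S p x - poly_op S q x"
  using poly_op_add[of "p - q" q x] by simp

lemma poly_op_commute:
  assumes "bounded_linear F" "\<And>c x. F (c *\<^sub>C x) = c *\<^sub>C F x" "\<And>x. F (S x) = S (F x)"
  shows "F (poly_op S p x) = poly_op S p (F x)"
proof -
  interpret F: bounded_linear F by fact
  show ?thesis
    by (induction p) (simp_all add: poly_op_pCons F.zero F.add assms)
qed

lemma poly_op_mult: "poly_op S (p * q) x = poly_op S p (poly_op S q x)"
  by (induction p) (simp_all add: poly_op_add poly_op_smult poly_op_pCons)

lemma poly_op_sym:
  assumes "real_coeffs p"
  shows "inner (poly_op S p x) y = inner x (poly_op S p y)"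
  using assms
proof (induction p arbitrary: x y)
  case (pCons a p)
  then have "cnj a = a" and p: "real_coeffs p" by (simp_all add: real_coeffs_pCons Reals_cnj_iff)
  moreover have "inner (S (poly_op S p x)) y = inner x (S (poly_op S p y))"
    using pCons.IH[OF p] poly_op_commute[OF bounded_linear_S] by (simp add: S_sym S_scaleC)
  ultimately show ?case
    by (simp add: poly_op_pCons inner_add_left inner_add_right inner_scaleC_left)
qed simp

text \<open>For non-real \<open>z\<close>, the vector \<open>\<i> *\<^sub>C x\<close> is
  real-orthogonal to \<open>S x - Re z *\<^sub>R x\<close>, so Pythagoras gives the bound
  \<open>\<bar>Im z\<bar>\<close>. For real \<open>z\<close>, the quadratic form of
  \<open>S - z\<close> stays away from 0.\<close>

lemma bounded_below_linear_factor:
  assumes "\<And>s. s \<in> {0..1} \<Longrightarrow> z \<noteq> complex_of_real s"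
  shows "\<exists>d>0. \<forall>x. d * norm x \<le> norm (poly_op S [:-z, 1:] x)"
proof -
  have eq: "poly_op S [:-z, 1:] x = (S x - Re z *\<^sub>R x) - Im z *\<^sub>R (\<i> *\<^sub>C x)" for x
    by (simp add: poly_op_pCons scaleC_minus_left scaleC_eq_Re_Im[of z x] S.zero algebra_simps)
  show ?thesis
  proof (cases "Im z = 0")
    case False
    have "\<bar>Im z\<bar> * norm x \<le> norm (poly_op S [:-z, 1:] x)" for x
    proof -
      have "inner (S x) (\<i> *\<^sub>C x) = 0"
      proof -
        have "inner (S x) (\<i> *\<^sub>C x) = inner x (\<i> *\<^sub>C S x)" by (simp add: S_sym S_scaleC)
        also have "\<dots> = - inner (\<i> *\<^sub>C x) (S x)" by (simp add: inner_scaleC_left scaleC_minus_left)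
        finally show ?thesis by (simp add: inner_commute)
      qed
      then have "inner (S x - Re z *\<^sub>R x) (\<i> *\<^sub>C x) = 0"
        by (simp add: inner_diff_left inner_i_self)
      then have "(norm (poly_op S [:-z, 1:] x))\<^sup>2
          = (norm (S x - Re z *\<^sub>R x))\<^sup>2 + (Im z)\<^sup>2 * (norm x)\<^sup>2"
        unfolding eq norm_diff_scaleR_power2 by (simp add: norm_scaleC)
      then have "(\<bar>Im z\<bar> * norm x)\<^sup>2 \<le> (norm (poly_op S [:-z, 1:] x))\<^sup>2"
        by (simp add: power_mult_distrib)
      then show ?thesis by (rule power2_le_imp_le) simp
    qed
    then show ?thesis using False by (intro exI[of _ "\<bar>Im z\<bar>"]) simp
  next
    case True
    then have "z = complex_of_real (Re z)" by (simp add: complex_eq_iff)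
    then have out: "Re z < 0 \<or> Re z > 1" using assms[of "Re z"] by force
    \<comment> \<open>The distance from the real number \<open>z\<close> to
      \<open>[0, 1]\<close>.\<close>
    define d where "d = max (- Re z) (Re z - 1)"
    have "d * norm x \<le> norm (poly_op S [:-z, 1:] x)" for x
    proof -
      have "d * (norm x)\<^sup>2 \<le> \<bar>inner (S x - Re z *\<^sub>R x) x\<bar>"
      proof -
        have "inner (S x - Re z *\<^sub>R x) x = inner (S x) x - Re z * (norm x)\<^sup>2"
          by (simp add: inner_diff_left power2_norm_eq_inner)
        then show ?thesis using S_nonneg[of x] S_le[of x]
          by (auto simp: d_def max_def algebra_simps)
      qed
      also have "\<dots> \<le> norm (S x - Re z *\<^sub>R x) * norm x" by (rule Cauchy_Schwarz_ineq2)
      finally have "(d * norm x) * norm x \<le> norm (S x - Re z *\<^sub>R x) * norm x"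
        by (simp add: power2_eq_square mult.assoc)
      then have "d * norm x \<le> norm (S x - Re z *\<^sub>R x)"
        by (cases "x = 0") simp_all
      then show ?thesis using True by (simp add: eq)
    qed
    moreover have "d > 0" using out by (auto simp: d_def)
    ultimately show ?thesis by blast
  qed
qed

text \<open>The roots of \<open>p\<close> are split off one at a time; the lower bounds of the
  factors multiply because \<open>poly_op\<close> is multiplicative.\<close>

lemma poly_op_bounded_below:
  assumes "\<And>s. s \<in> {0..1} \<Longrightarrow> poly p (complex_of_real s) \<noteq> 0"
  shows "\<exists>d>0. \<forall>x. d * norm x \<le> norm (poly_op S p x)"
  using assms
proof (induction "degree p" arbitrary: p rule: less_induct)
  case less
  show ?case
  proof (cases "degree p = 0")
    case True
    then obtain a where a: "p = [:a:]" by (metis degree_eq_zeroE)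
    then have "a \<noteq> 0" using less.prems[of 0] by simp
    then show ?thesis
      by (intro exI[of _ "cmod a"]) (simp add: a poly_op_pCons S.zero norm_scaleC)
  next
    case False
    then obtain z where "poly p z = 0"
      using fundamental_theorem_of_algebra[of p] by (auto simp: constant_degree)
    then obtain q where q: "p = [:-z, 1:] * q" by (auto simp: poly_eq_0_iff_dvd)
    have "q \<noteq> 0" using False q by auto
    then have "degree p = Suc (degree q)" unfolding q by (subst degree_mult_eq) auto
    moreover have "poly q (of_real s) \<noteq> 0" if "s \<in> {0..1}" for s
      using less.prems[OF that] by (auto simp: q)
    ultimately obtain d1 where d1: "d1 > 0" "\<And>x. d1 * norm x \<le> norm (poly_op S q x)"
      using less.hyps[of q] by auto
    have "z \<noteq> of_real s" if "s \<in> {0..1}" for s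
      using less.prems[OF that] by (auto simp: q)
    then obtain d2 where d2: "d2 > 0" "\<And>x. d2 * norm x \<le> norm (poly_op S [:-z, 1:] x)"
      using bounded_below_linear_factor by blast
    have "d2 * d1 * norm x \<le> norm (poly_op S p x)" for x
    proof -
      have "d2 * (d1 * norm x) \<le> d2 * norm (poly_op S q x)"
        using d1(2) d2(1) by simp
      also have "\<dots> \<le> norm (poly_op S p x)" unfolding q poly_op_mult by (rule d2(2))
      finally show ?thesis by (simp add: mult.assoc)
    qed
    then show ?thesis using d1(1) d2(1) by (intro exI[of _ "d2 * d1"]) simp
  qed
qed

text \<open>If the operator norm \<open>l\<close> of \<open>p(S)\<close> exceeded \<open>M\<close>, then \<open>l\<^sup>2 - p\<^sup>2\<close> would have no root in \<open>[0, 1]\<close>, so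
  \<open>l\<^sup>2 - p(S)\<^sup>2\<close> would be bounded below, which is impossible for a self-adjoint operator of norm \<open>l\<close>.\<close>

lemma norm_poly_op_le:
  assumes p: "real_coeffs p" and M: "\<And>s. s \<in> {0..1} \<Longrightarrow> cmod (poly p (of_real s)) \<le> M"
  shows "norm (poly_op S p x) \<le> M * norm x"
proof -
  let ?P = "poly_op S p"
  define l where "l = onorm ?P"
  note bl = bounded_linear_poly_op[of p]
  have M0: "0 \<le> M" using order_trans[OF norm_ge_zero M[of 0]] by simp
  have l: "norm (?P y) \<le> l * norm y" for y unfolding l_def by (rule onorm[OF bl])
  have "l \<le> M"
  proof (rule ccontr)
    assume "\<not> l \<le> M"
    then have lM: "M < l" by simp
    then have lpos: "l > 0" using M0 by simp
    let ?q = "[:complex_of_real (l\<^sup>2):] - p * p"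
    have "poly ?q (of_real s) \<noteq> 0" if s: "s \<in> {0..1}" for s
    proof
      assume "poly ?q (of_real s) = 0"
      then have "poly p (of_real s) * poly p (of_real s) = of_real (l\<^sup>2)" by simp
      then have "cmod (poly p (of_real s)) * cmod (poly p (of_real s)) = l\<^sup>2"
        by (metis abs_power2 norm_mult norm_of_real)
      moreover have "cmod (poly p (of_real s)) * cmod (poly p (of_real s)) \<le> M * M"
        using M[OF s] M0 by (intro mult_mono) auto
      moreover have "M * M < l\<^sup>2"
        using lM M0 by (simp add: power2_eq_square mult_strict_mono')
      ultimately show False by simp
    qed
    then obtain d where d: "d > 0" "\<And>x. d * norm x \<le> norm (poly_op S ?q x)"
      using poly_op_bounded_below by blast
    \<comment> \<open>Expand the squared norm of \<open>P (P y) - l^2 y\<close>, which is at least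
      \<open>(d * norm y)^2\<close>, and bound its first term by \<open>l^2 * norm (P y)^2\<close>:
      the squared norm of \<open>P\<close> falls short of \<open>l^2\<close> by a fixed
      amount.\<close>
    have key: "(norm (?P y))\<^sup>2 \<le> (l\<^sup>2 - d\<^sup>2 / l\<^sup>2) * (norm y)\<^sup>2" for y
    proof -
      have "inner (?P (?P y)) y = (norm (?P y))\<^sup>2"
        by (simp add: poly_op_sym[OF p] power2_norm_eq_inner)
      then have "(norm (?P (?P y) - l\<^sup>2 *\<^sub>R y))\<^sup>2
          = (norm (?P (?P y)))\<^sup>2 - 2 * l\<^sup>2 * (norm (?P y))\<^sup>2 + (l\<^sup>2)\<^sup>2 * (norm y)\<^sup>2"
        by (simp add: norm_diff_scaleR_power2)
      moreover have "(norm (?P (?P y)))\<^sup>2 \<le> l\<^sup>2 * (norm (?P y))\<^sup>2"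
        using power_mono[OF l[of "?P y"]] by (simp add: power_mult_distrib)
      moreover have "(d * norm y)\<^sup>2 \<le> (norm (?P (?P y) - l\<^sup>2 *\<^sub>R y))\<^sup>2"
      proof (rule power_mono)
        have "poly_op S ?q y = l\<^sup>2 *\<^sub>R y - ?P (?P y)"
          by (simp add: poly_op_diff poly_op_mult poly_op_pCons S.zero scaleR_scaleC)
        then show "d * norm y \<le> norm (?P (?P y) - l\<^sup>2 *\<^sub>R y)"
          using d(2)[of y] by (simp add: norm_minus_commute)
      qed (use d in simp)
      ultimately have "l\<^sup>2 * (norm (?P y))\<^sup>2 \<le> ((l\<^sup>2)\<^sup>2 - d\<^sup>2) * (norm y)\<^sup>2"
        by (simp add: power_mult_distrib left_diff_distrib)
      also have "\<dots> = l\<^sup>2 * ((l\<^sup>2 - d\<^sup>2 / l\<^sup>2) * (norm y)\<^sup>2)"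
        using lpos by (simp add: right_diff_distrib left_diff_distrib power2_eq_square)
      finally show ?thesis using lpos by simp
    qed
    \<comment> \<open>The cut-off at 0 avoids discussing the sign of the difference.\<close>
    define k where "k = sqrt (max 0 (l\<^sup>2 - d\<^sup>2 / l\<^sup>2))"
    have "norm (?P y) \<le> k * norm y" for y
    proof (rule power2_le_imp_le)
      have "(norm (?P y))\<^sup>2 \<le> max 0 (l\<^sup>2 - d\<^sup>2 / l\<^sup>2) * (norm y)\<^sup>2"
        using key[of y] by (rule order_trans) (intro mult_right_mono, auto)
      then show "(norm (?P y))\<^sup>2 \<le> (k * norm y)\<^sup>2" by (simp add: k_def power_mult_distrib)
    qed (simp add: k_def)
    then have "l \<le> k" unfolding l_def by (intro onorm_bound) (simp_all add: k_def)
    moreover have "k < l"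
    proof -
      have "max 0 (l\<^sup>2 - d\<^sup>2 / l\<^sup>2) < l\<^sup>2" using lpos d(1) by simp
      then have "k < sqrt (l\<^sup>2)" unfolding k_def by (rule real_sqrt_less_mono)
      then show ?thesis using lpos by simp
    qed
    ultimately show False by simp
  qed
  then show ?thesis using l[of x] by (meson mult_right_mono norm_ge_zero order_trans)
qed

text \<open>\<open>W\<close> is the kernel of \<open>f(S)\<close> for \<open>f s = max (s - e) 0\<close>, and \<open>v = g(S) c\<close> for \<open>g s = 1 / max s e\<close>, which is the
  inverse of \<open>s\<close> where \<open>f\<close> does not vanish. Both are expressed through polynomial approximations.\<close>

lemma spectral_subspace:
  assumes e: "e > 0"
  obtains v W where "complex_subspace W" "closed W" "S v - c \<in> W"
    "\<And>F w. bounded_linear F \<Longrightarrow> (\<And>a x. F (a *\<^sub>C x) = a *\<^sub>C F x) \<Longrightarrow>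
       (\<And>x. F (S x) = S (F x)) \<Longrightarrow> w \<in> W \<Longrightarrow> F w \<in> W"
    "\<And>x. (\<And>y. S y \<in> W) \<Longrightarrow> norm (S (S x)) \<le> e * norm x"
proof -
  define f where "f s = max (s - e) 0" for s :: real
  define g where "g s = inverse (max s e)" for s :: real
  define r where "r n = inverse (real (Suc n))" for n
  have r0: "r \<longlonglongrightarrow> 0" unfolding r_def by (rule LIMSEQ_inverse_real_of_nat)
  have rpos: "r n > 0" and r1: "r n \<le> 1" for n
    by (auto simp: r_def inverse_le_1_iff)
  have contf: "continuous_on {0..1} f" unfolding f_def by (intro continuous_intros)
  have contg: "continuous_on {0..1} g"
    unfolding g_def using e by (intro continuous_intros) auto
  \<comment> \<open>This identity puts \<open>S v - c\<close> into \<open>W\<close>; the bound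
    \<open>\<bar>s - f s\<bar> \<le> e\<close> below gives the final estimate.\<close>
  have fg: "f s * (1 - s * g s) = 0" for s
    using e by (auto simp: f_def g_def max_def)
  have sg: "0 \<le> 1 - s * g s" "1 - s * g s \<le> 1" if "s \<in> {0..1}" for s
    using e that by (auto simp: g_def max_def field_simps)
  have f01: "\<bar>f s\<bar> \<le> 1" "\<bar>s - f s\<bar> \<le> e" if "s \<in> {0..1}" for s
    using e that by (auto simp: f_def max_def)
  have "\<exists>p. real_coeffs p \<and> (\<forall>s\<in>{0..1}. cmod (poly p (of_real s) - of_real (f s)) \<le> r n)" for n
    using real_coeffs_approximation[OF contf rpos] by metis
  then obtain p where p: "\<And>n. real_coeffs (p n)"
    and pf: "\<And>n s. s \<in> {0..1} \<Longrightarrow> cmod (poly (p n) (of_real s) - of_real (f s)) \<le> r n" by metis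
  have "\<exists>p. real_coeffs p \<and> (\<forall>s\<in>{0..1}. cmod (poly p (of_real s) - of_real (g s)) \<le> r n)" for n
    using real_coeffs_approximation[OF contg rpos] by metis
  then obtain q where q: "\<And>n. real_coeffs (q n)"
    and qg: "\<And>n s. s \<in> {0..1} \<Longrightarrow> cmod (poly (q n) (of_real s) - of_real (g s)) \<le> r n" by metis
  let ?P = "\<lambda>n. poly_op S (p n)" and ?Q = "\<lambda>n. poly_op S (q n)"
  \<comment> \<open>A bound uniform in \<open>n\<close>; it makes \<open>W\<close> closed.\<close>
  have P_le: "norm (?P n x) \<le> 2 * norm x" for n x
  proof (rule norm_poly_op_le[OF p])
    fix s :: real assume s: "s \<in> {0..1}"
    have "cmod (poly (p n) (of_real s)) \<le> cmod (poly (p n) (of_real s) - of_real (f s)) + cmod (of_real (f s))"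
      by (metis diff_add_cancel norm_triangle_ineq)
    then show "cmod (poly (p n) (of_real s)) \<le> 2"
      using pf[OF s, of n] f01(1)[OF s] r1[of n] by simp
  qed
  have Q_diff: "norm (?Q m c - ?Q n c) \<le> (r m + r n) * norm c" for m n
    unfolding poly_op_diff[symmetric]
  proof (rule norm_poly_op_le[OF real_coeffs_diff[OF q q]])
    fix s :: real assume s: "s \<in> {0..1}"
    have "poly (q m - q n) (of_real s) = (poly (q m) (of_real s) - of_real (g s)) - (poly (q n) (of_real s) - of_real (g s))"
      by simp
    then show "cmod (poly (q m - q n) (of_real s)) \<le> r m + r n"
      using norm_triangle_le_diff[OF add_mono[OF qg[OF s, of m] qg[OF s, of n]]] by simp
  qed
  have "Cauchy (\<lambda>n. ?Q n c)"
    unfolding Cauchy_altdef dist_norm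
  proof (intro allI impI)
    fix d :: real assume d: "d > 0"
    have "(\<lambda>n. 2 * r n * norm c) \<longlonglongrightarrow> 2 * 0 * norm c" by (intro tendsto_intros r0)
    then have "eventually (\<lambda>n. 2 * r n * norm c < d) sequentially"
      using d by (intro order_tendstoD) auto
    then obtain M where M: "2 * r M * norm c < d" by (auto simp: eventually_sequentially)
    have "norm (?Q m c - ?Q n c) < d" if "m \<ge> M" "n > m" for m n
    proof -
      have "r m \<le> r M" "r n \<le> r M" using that by (auto simp: r_def)
      then have "(r m + r n) * norm c \<le> 2 * r M * norm c" by (intro mult_right_mono) auto
      then show ?thesis using Q_diff[of m n] M by linarith
    qed
    then show "\<exists>M. \<forall>m\<ge>M. \<forall>n>m. norm (?Q m c - ?Q n c) < d" by blast
  qed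
  then obtain v where v: "(\<lambda>n. ?Q n c) \<longlonglongrightarrow> v" using Cauchy_convergent convergent_def by blast
  \<comment> \<open>The approximants themselves describe the kernel, so \<open>f(S)\<close> is never
    constructed as a limit operator.\<close>
  define W where "W = {w. (\<lambda>n. ?P n w) \<longlonglongrightarrow> 0}"
  have bl: "bounded_linear (?P n)" for n by (rule bounded_linear_poly_op)
  have P_add: "?P n (x + y) = ?P n x + ?P n y" for n x y
    using bl by (rule linear_add[OF bounded_linear.linear])
  have P_diff: "?P n (x - y) = ?P n x - ?P n y" for n x y
    using bl by (rule linear_diff[OF bounded_linear.linear])
  have P_scaleC: "?P n (a *\<^sub>C x) = a *\<^sub>C ?P n x" for n a x
    by (rule poly_op_commute[OF bounded_linear_scaleC, symmetric])
      (simp_all add: scaleC_scaleC mult.commute S_scaleC)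
  have "complex_subspace W"
    unfolding complex_subspace_def
  proof (intro conjI ballI allI)
    show "0 \<in> W" using P_diff[of _ 0 0] by (simp add: W_def)
    show "x + y \<in> W" if "x \<in> W" "y \<in> W" for x y
      using that tendsto_add[of "\<lambda>n. ?P n x" 0 _ "\<lambda>n. ?P n y" 0] by (simp add: W_def P_add)
    show "a *\<^sub>C x \<in> W" if "x \<in> W" for a x
      using that bounded_linear.tendsto[OF bounded_linear_scaleC[of a], of "\<lambda>n. ?P n x" 0]
      by (simp add: W_def P_scaleC)
  qed
  moreover have "closed W"
    unfolding closed_sequential_limits
  proof (intro allI impI, elim conjE)
    fix x l assume xW: "\<forall>n. x n \<in> W" and xl: "x \<longlonglongrightarrow> l"
    show "l \<in> W" unfolding W_def mem_Collect_eq
    proof (rule LIMSEQ_I)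
      fix d :: real assume d: "d > 0"
      obtain k where k: "norm (x k - l) < d / 4"
        using LIMSEQ_D[OF xl, of "d / 4"] d by auto
      have "(\<lambda>n. ?P n (x k)) \<longlonglongrightarrow> 0" using xW by (simp add: W_def)
      then obtain N where N: "\<And>n. n \<ge> N \<Longrightarrow> norm (?P n (x k)) < d / 2"
        using LIMSEQ_D[of _ 0 "d / 2"] d by auto
      have "norm (?P n l) < d" if "n \<ge> N" for n
      proof -
        have "?P n l = ?P n (x k) - ?P n (x k - l)" by (simp add: P_diff)
        then have "norm (?P n l) \<le> norm (?P n (x k)) + norm (?P n (x k - l))"
          by (simp add: norm_triangle_ineq4)
        then show ?thesis using N[OF that] P_le[of n "x k - l"] k by linarith
      qed
      then show "\<exists>N. \<forall>n\<ge>N. norm (?P n l - 0) < d" by auto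
    qed
  qed
  moreover have "S v - c \<in> W"
  proof -
    have bound: "norm (?P n (S v - c)) \<le> 2 * r n * norm c" for n
    proof -
      \<comment> \<open>The limit over \<open>m\<close> comes first and turns \<open>?Q m c\<close>
        into \<open>v\<close>; only then does \<open>n\<close> grow. With
        \<open>h = s * q m - 1\<close>, the term \<open>(p n - f) * h\<close> is small because
        \<open>h\<close> is bounded by 2, and \<open>f * h\<close> is small because \<open>f\<close>
        annihilates \<open>s * g - 1\<close>.\<close>
      have le: "norm (?P n (S (?Q m c) - c)) \<le> (2 * r n + r m) * norm c" for m
      proof -
        let ?t = "p n * ([:0, 1:] * q m - [:1:])"
        have "?P n (S (?Q m c) - c) = poly_op S ?t c"
          by (simp only: poly_op_mult poly_op_diff poly_op_pCons poly_op_0) (simp add: S.zero)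
        moreover have "norm (poly_op S ?t c) \<le> (2 * r n + r m) * norm c"
        proof (rule norm_poly_op_le)
          show "real_coeffs ?t"
            by (intro real_coeffs_mult real_coeffs_diff p q) (simp_all add: real_coeffs_pCons)
          fix s :: real assume s: "s \<in> {0..1}"
          let ?a = "poly (p n) (of_real s)" and ?b = "poly (q m) (of_real s)"
          let ?h = "complex_of_real s * ?b - 1"
          have h: "?h = of_real s * (?b - of_real (g s)) - of_real (1 - s * g s)"
            by (simp add: algebra_simps)
          have sb: "cmod (of_real s * (?b - of_real (g s))) \<le> r m"
            unfolding norm_mult using mult_mono[of s 1 "cmod (?b - of_real (g s))" "r m"] qg[OF s, of m] s
            by simp
          have "cmod (of_real (1 - s * g s)) \<le> 1" unfolding norm_of_real using sg[OF s] by simp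
          then have h2: "cmod ?h \<le> 2"
            unfolding h using norm_triangle_ineq4[of "of_real s * (?b - of_real (g s))" "of_real (1 - s * g s)"]
              sb r1[of m] by linarith
          have "of_real (f s) * complex_of_real (1 - s * g s) = 0"
            unfolding of_real_mult[symmetric] fg by simp
          then have fh: "of_real (f s) * ?h = of_real (f s) * (of_real s * (?b - of_real (g s)))"
            unfolding h by (simp only: right_diff_distrib[of "of_real (f s)"]) simp
          have "poly ?t (of_real s) = (?a - of_real (f s)) * ?h + of_real (f s) * ?h"
            by (simp add: algebra_simps)
          then have "cmod (poly ?t (of_real s)) \<le> cmod ((?a - of_real (f s)) * ?h) + cmod (of_real (f s) * ?h)"
            by (simp only: norm_triangle_ineq)
          moreover have "cmod ((?a - of_real (f s)) * ?h) \<le> r n * 2"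
            unfolding norm_mult using pf[OF s, of n] h2 less_imp_le[OF rpos] by (intro mult_mono) auto
          moreover have "cmod (of_real (f s) * ?h) \<le> 1 * r m"
            unfolding fh norm_mult[of "of_real (f s)"] using sb f01(1)[OF s] by (intro mult_mono) auto
          ultimately show "cmod (poly ?t (of_real s)) \<le> 2 * r n + r m" by linarith
        qed
        ultimately show ?thesis by simp
      qed
      have "(\<lambda>m. norm (?P n (S (?Q m c) - c))) \<longlonglongrightarrow> norm (?P n (S v - c))"
        by (intro tendsto_intros bounded_linear.tendsto[OF bl] S.tendsto v)
      moreover have "(\<lambda>m. (2 * r n + r m) * norm c) \<longlonglongrightarrow> (2 * r n + 0) * norm c"
        by (intro tendsto_intros r0)
      ultimately have "norm (?P n (S v - c)) \<le> (2 * r n + 0) * norm c"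
        by (rule LIMSEQ_le) (use le in blast)
      then show ?thesis by simp
    qed
    have "(\<lambda>n. 2 * r n * norm c) \<longlonglongrightarrow> 2 * 0 * norm c" by (intro tendsto_intros r0)
    then have lim: "(\<lambda>n. 2 * r n * norm c) \<longlonglongrightarrow> 0" by simp
    have ev: "\<forall>\<^sub>F n in sequentially. norm (?P n (S v - c)) \<le> 2 * r n * norm c"
      by (rule always_eventually) (rule allI, rule bound)
    have "(\<lambda>n. ?P n (S v - c)) \<longlonglongrightarrow> 0" by (rule Lim_null_comparison[OF ev lim])
    then show ?thesis unfolding W_def by (rule CollectI)
  qed
  moreover have "F w \<in> W"
    if F: "bounded_linear F" "\<And>a x. F (a *\<^sub>C x) = a *\<^sub>C F x" "\<And>x. F (S x) = S (F x)"
      and w: "w \<in> W" for F w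
  proof -
    have "(\<lambda>n. ?P n w) \<longlonglongrightarrow> 0" using w unfolding W_def by (rule CollectD)
    from bounded_linear.tendsto[OF F(1) this]
    have "(\<lambda>n. F (?P n w)) \<longlonglongrightarrow> F 0" .
    then show ?thesis
      unfolding W_def mem_Collect_eq poly_op_commute[OF F] linear_0[OF bounded_linear.linear[OF F(1)]] .
  qed
  moreover have "norm (S (S x)) \<le> e * norm x" if W: "\<And>x. S x \<in> W" for x
  proof -
    have le: "norm (S (S x)) \<le> (e + r n) * norm x + norm (?P n (S x))" for n
    proof -
      \<comment> \<open>This is \<open>s * (s - p s)\<close>, nearly \<open>s * (s - f s)\<close>.
        The remaining term \<open>?P n (S x)\<close> tends to 0 because \<open>S x\<close> lies in
        \<open>W\<close>.\<close>
      let ?t = "[:0, 0, 1:] - p n * [:0, 1:]"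
      have "S (S x) - ?P n (S x) = poly_op S ?t x"
        by (simp only: poly_op_mult poly_op_diff poly_op_pCons poly_op_0) (simp add: S.zero)
      moreover have "norm (poly_op S ?t x) \<le> (e + r n) * norm x"
      proof (rule norm_poly_op_le)
        show "real_coeffs ?t"
          by (intro real_coeffs_mult real_coeffs_diff p) (simp_all add: real_coeffs_pCons)
        fix s :: real assume s: "s \<in> {0..1}"
        let ?a = "poly (p n) (of_real s)"
        have "poly ?t (of_real s) = of_real s * (of_real (s - f s) - (?a - of_real (f s)))"
          by (simp add: algebra_simps)
        then have "cmod (poly ?t (of_real s)) = s * cmod (of_real (s - f s) - (?a - of_real (f s)))"
          using s by (simp only: norm_mult norm_of_real) simp
        also have "\<dots> \<le> 1 * (e + r n)"
        proof (rule mult_mono)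
          have "cmod (of_real (s - f s)) \<le> e" unfolding norm_of_real by (rule f01(2)[OF s])
          then show "cmod (of_real (s - f s) - (?a - of_real (f s))) \<le> e + r n"
            by (intro norm_triangle_le_diff add_mono pf[OF s])
        qed (use s in auto)
        finally show "cmod (poly ?t (of_real s)) \<le> e + r n" by simp
      qed
      ultimately show ?thesis using norm_triangle_sub[of "S (S x)" "?P n (S x)"] by simp
    qed
    have "(\<lambda>n. (e + r n) * norm x + norm (?P n (S x))) \<longlonglongrightarrow> (e + 0) * norm x + norm (0::'h)"
      using W[of x] by (intro tendsto_intros r0) (simp add: W_def)
    then show ?thesis using LIMSEQ_le_const[of _ "e * norm x" "norm (S (S x))"] le by simp
  qed
  ultimately show ?thesis using that by blast
qed

end

section \<open>Measures on the group and on the cosets\<close>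

lemma open_left_translate:
  fixes U :: "'g::topological_group_add set"
  assumes "open U" shows "open ((\<lambda>x. g + x) ` U)"
proof -
  have "(\<lambda>x. g + x) ` U = (\<lambda>x. - g + x) -` U"
    by (auto simp: image_iff add.assoc[symmetric] intro!: bexI[of _ "- g + _"])
  then show ?thesis
    using assms by (auto intro!: open_vimage continuous_intros)
qed

lemma open_uminus_image:
  fixes U :: "'g::topological_group_add set"
  assumes "open U" shows "open (uminus ` U)"
proof -
  have "uminus ` U = uminus -` U" by force
  then show ?thesis using assms by (auto intro!: open_vimage continuous_intros)
qed

lemma compact_set_add:
  fixes K L :: "'g::topological_group_add set"
  assumes "compact K" "compact L" shows "compact ((\<lambda>(x, y). x + y) ` (K \<times> L))"
  by (intro compact_continuous_image compact_Times assms)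
    (auto simp: case_prod_unfold intro!: continuous_intros)

lemma compact_uminus_image:
  fixes K :: "'g::topological_group_add set"
  assumes "compact K" shows "compact (uminus ` K)"
  by (intro compact_continuous_image assms) (auto intro!: continuous_intros)

text \<open>The tube lemma for addition: compactness lets one neighbourhood of 0 serve all points of
  \<open>K\<close>.\<close>

lemma compact_add_zero_neighbourhood:
  fixes K :: "'g::topological_group_add set"
  assumes "compact K" "open U" "K \<subseteq> U"
  obtains V where "open V" "0 \<in> V" "\<And>x v. x \<in> K \<Longrightarrow> v \<in> V \<Longrightarrow> x + v \<in> U"
proof -
  let ?W = "(\<lambda>(v, x). x + v) -` U :: ('g \<times> 'g) set"
  have "open ?W"
    using assms(2) by (intro open_vimage) (auto simp: case_prod_unfold intro!: continuous_intros)
  moreover have "{0} \<times> K \<subseteq> ?W" using assms(3) by auto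
  ultimately obtain V where "0 \<in> V" "open V" "V \<times> K \<subseteq> ?W"
    using Elementary_Topology.tube_lemma[OF assms(1)] by metis
  then show ?thesis by (intro that[of V]) auto
qed

lemma zero_neighbourhood_diff:
  fixes V :: "'g::topological_group_add set"
  assumes "open V" "0 \<in> V"
  obtains W where "open W" "0 \<in> W" "\<And>w w'. w \<in> W \<Longrightarrow> w' \<in> W \<Longrightarrow> - w + w' \<in> V"
proof -
  let ?W = "(\<lambda>(v, x). - v + x) -` V :: ('g \<times> 'g) set"
  have "open ?W"
    using assms(1) by (intro open_vimage) (auto simp: case_prod_unfold intro!: continuous_intros)
  moreover have "(0, 0) \<in> ?W" using assms(2) by simp
  ultimately obtain A B where "open A" "open B" "(0, 0) \<in> A \<times> B" "A \<times> B \<subseteq> ?W"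
    by (rule open_prod_elim)
  then show ?thesis by (intro that[of "A \<inter> B"]) auto
qed

lemma locally_compact_t2_compact_neighbourhood:
  fixes x :: "'a::t2_space"
  assumes "locally_compact_space (euclidean :: 'a topology)" "open U" "x \<in> U"
  obtains O' K where "open O'" "compact K" "x \<in> O'" "O' \<subseteq> K" "K \<subseteq> U"
proof -
  have "Hausdorff_space (euclidean :: 'a topology)"
    unfolding Hausdorff_space_def disjnt_def using hausdorff by simp blast
  then have "neighbourhood_base_of (compactin euclidean) (euclidean :: 'a topology)"
    using assms(1) locally_compact_space_neighbourhood_base by blast
  note base = this[unfolded neighbourhood_base_of, rule_format]
  have "openin euclidean U \<and> x \<in> U" using assms(2,3) by simp
  from base[OF this] obtain O' K
    where "openin euclidean O'" "compactin euclidean K" "x \<in> O'" "O' \<subseteq> K" "K \<subseteq> U" by (elim exE conjE)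
  then show ?thesis by (intro that[of O' K]) simp_all
qed

text \<open>An infinite subset of a compact set accumulates; closedness puts the accumulation point
  into \<open>H\<close>, where discreteness excludes it.\<close>

lemma finite_closed_discrete_Int_compact:
  fixes H :: "'a::topological_space set"
  assumes "closed H" "discrete H" "compact M"
  shows "finite (H \<inter> M)"
proof (rule ccontr)
  assume "infinite (H \<inter> M)"
  then obtain x where "x islimpt (H \<inter> M)"
    using Heine_Borel_imp_Bolzano_Weierstrass[OF assms(3)] by blast
  then have x: "x islimpt H" by (rule islimpt_subset) simp
  then have "x \<in> H" using assms(1) closed_limpt by blast
  then show False using x assms(2) by (auto simp: discrete_def isolated_in_islimpt_iff)
qed

text \<open>Finitely many translates of \<open>W\<close> cover \<open>K\<close> and are made
  disjoint; this rounds the points of \<open>K\<close> to centres \<open>x i\<close> in a Borel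
  way.\<close>

lemma finite_borel_partition:
  fixes K :: "'g::{topological_group_add, t2_space} set"
  assumes "compact K" "open W" "0 \<in> W"
  obtains n x B where "\<And>i::nat. B i \<in> sets borel" "disjoint_family B" "(\<Union>i<n. B i) = K"
    "\<And>i z. z \<in> B i \<Longrightarrow> \<exists>w\<in>W. z = x i + w"
proof -
  have "K \<subseteq> (\<Union>x\<in>K. (\<lambda>w. x + w) ` W)" using assms(3) by force
  then obtain C where C: "C \<subseteq> K" "finite C" "K \<subseteq> (\<Union>x\<in>C. (\<lambda>w. x + w) ` W)"
    using compactE_image[OF assms(1), of K] open_left_translate[OF assms(2)] by metis
  obtain n :: nat and x where "C = x ` {i. i < n}"
    using C(2) finite_imp_nat_seg_image_inj_on by metis
  then have Cx: "C = x ` {..<n}" by (simp add: lessThan_def)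
  define A where "A i = K \<inter> (\<lambda>w. x i + w) ` W" for i
  have "closed K" using assms(1) by (rule compact_imp_closed)
  then have A: "range A \<subseteq> sets borel"
    using open_left_translate[OF assms(2)] by (auto simp: A_def)
  show ?thesis
  proof (rule that[of "disjointed A" n x])
    show "disjointed A i \<in> sets borel" for i
      using sets.range_disjointed_sets[OF A] by blast
    show "disjoint_family (disjointed A)" by (rule disjoint_family_disjointed)
    show "(\<Union>i<n. disjointed A i) = K"
      using C(3) unfolding lessThan_atLeast0 finite_UN_disjointed_eq Cx by (auto simp: A_def)
    show "\<exists>w\<in>W. z = x i + w" if "z \<in> disjointed A i" for i z
      using that disjointed_subset[of A i] by (auto simp: A_def)
  qed
qed

section \<open>Radon measures and Haar measure\<close>

lemma sets_radon_measure_open: "radon_measure T M \<Longrightarrow> openin T U \<Longrightarrow> U \<in> sets M"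
  by (simp add: radon_measure_def)

text \<open>Inner regularity reduces the claim to compact sets, where finitely many null sets
  suffice; the cover may therefore be uncountable. Applied to the translates of one open set, it
  yields full support.\<close>

lemma radon_measure_null_cover:
  assumes M: "radon_measure T M"
    and cover: "topspace T \<subseteq> \<Union>\<U>" "\<And>U. U \<in> \<U> \<Longrightarrow> openin T U \<and> emeasure M U = 0"
  shows "emeasure M (topspace T) = 0"
proof -
  have "emeasure M K = 0" if K: "compactin T K" for K
  proof -
    have "K \<subseteq> \<Union>\<U>" using K cover(1) compactin_subset_topspace by blast
    then obtain \<F> where F: "finite \<F>" "\<F> \<subseteq> \<U>" "K \<subseteq> \<Union>\<F>"
      using compactinD[OF K, of \<U>] cover(2) by blast
    then have "\<F> \<subseteq> null_sets M"
      using cover(2) sets_radon_measure_open[OF M] by (auto simp: null_sets_def)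
    then have "\<Union>\<F> \<in> null_sets M" using F(1) by (intro null_sets.finite_Union)
    then have "emeasure M K \<le> 0" using F(3) emeasure_mono[of K "\<Union>\<F>" M] by (auto simp: null_sets_def)
    then show ?thesis by simp
  qed
  then have "(SUP K\<in>{K. compactin T K \<and> K \<subseteq> topspace T}. emeasure M K) \<le> 0"
    by (intro SUP_least) simp
  moreover have "emeasure M (topspace T) = (SUP K\<in>{K. compactin T K \<and> K \<subseteq> topspace T}. emeasure M K)"
    using M unfolding radon_measure_def by (metis openin_topspace)
  ultimately show ?thesis by simp
qed

lemma sets_haar_measure: "haar_measure \<mu> \<Longrightarrow> sets \<mu> = sets borel"
  by (simp add: haar_measure_def radon_measure_def borel_def)

lemma emeasure_haar_translate:
  assumes "haar_measure \<mu>" "A \<in> sets borel"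
  shows "emeasure \<mu> ((\<lambda>x. g + x) ` A) = emeasure \<mu> A"
  using assms sets_haar_measure[OF assms(1)] by (simp add: haar_measure_def)

lemma emeasure_haar_open_pos:
  fixes U :: "'g::topological_group_add set"
  assumes "haar_measure \<mu>" "open U" "U \<noteq> {}"
  shows "emeasure \<mu> U \<noteq> 0"
proof
  assume 0: "emeasure \<mu> U = 0"
  obtain u where u: "u \<in> U" using assms(3) by blast
  have "emeasure \<mu> (topspace euclidean) = 0"
  proof (rule radon_measure_null_cover)
    show "radon_measure euclidean \<mu>" using assms(1) by (simp add: haar_measure_def)
    have "x = (x - u) + u" for x by simp
    then show "topspace euclidean \<subseteq> \<Union> (range (\<lambda>g. (\<lambda>x. g + x) ` U))" using u by blast
    show "openin euclidean V \<and> emeasure \<mu> V = 0" if "V \<in> range (\<lambda>g. (\<lambda>x. g + x) ` U)" for V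
    proof -
      from that obtain g where V: "V = (\<lambda>x. g + x) ` U" by blast
      have "emeasure \<mu> V = emeasure \<mu> U"
        unfolding V using assms(1,2) by (intro emeasure_haar_translate) auto
      moreover have "open V" unfolding V by (rule open_left_translate[OF assms(2)])
      ultimately show ?thesis using 0 by simp
    qed
  qed
  then show False using assms(1) by (simp add: haar_measure_def)
qed

section \<open>The space of left cosets\<close>

lemma mem_left_coset_image_iff:
  assumes "add_subgroup H"
  shows "left_coset H g \<in> left_coset H ` U \<longleftrightarrow> (\<exists>h\<in>H. g + h \<in> U)"
proof
  assume "left_coset H g \<in> left_coset H ` U"
  then obtain u where u: "u \<in> U" "left_coset H g = left_coset H u" by blast
  have "u + 0 \<in> left_coset H u" using assms unfolding left_coset_def add_subgroup_def by blast
  then have "u \<in> left_coset H g" using u(2) by simp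
  then show "\<exists>h\<in>H. g + h \<in> U" using u(1) by (auto simp: left_coset_def)
next
  assume "\<exists>h\<in>H. g + h \<in> U"
  then obtain h where h: "h \<in> H" "g + h \<in> U" by blast
  have "left_coset H g = left_coset H (g + h)"
  proof (intro equalityI subsetI)
    fix x assume "x \<in> left_coset H g"
    then obtain k where "k \<in> H" "x = g + k" by (auto simp: left_coset_def)
    then have "x = (g + h) + (- h + k)" "- h + k \<in> H"
      using h assms by (auto simp: add_subgroup_def add.assoc)
    then show "x \<in> left_coset H (g + h)" by (auto simp: left_coset_def)
  next
    fix x assume "x \<in> left_coset H (g + h)"
    then show "x \<in> left_coset H g"
      using h assms by (auto simp: left_coset_def add_subgroup_def add.assoc)
  qed
  then show "left_coset H g \<in> left_coset H ` U" using h by blast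
qed

text \<open>The saturation of \<open>U\<close> is a union of right translates of \<open>U\<close>,
  hence open.\<close>

lemma openin_left_coset_image:
  fixes U :: "'g::topological_group_add set"
  assumes "add_subgroup H" "open U"
  shows "openin (coset_topology H) (left_coset H ` U)"
proof -
  have "left_coset H -` left_coset H ` U = (\<Union>h\<in>H. (\<lambda>x. x + h) -` U)"
    by (rule set_eqI) (simp add: mem_left_coset_image_iff[OF assms(1)])
  moreover have "open (\<Union>h\<in>H. (\<lambda>x. x + h) -` U)"
    using assms(2) by (intro open_UN ballI open_vimage continuous_intros)
  ultimately show ?thesis unfolding openin_coset_topology using image_mono[OF subset_UNIV] by simp
qed

lemma translate_left_coset: "(\<lambda>x. g + x) ` left_coset H x = left_coset H (g + x)"
  for g :: "'g::group_add"
  by (simp add: left_coset_def image_image add.assoc)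

text \<open>The points of \<open>U\<close> have compact neighbourhoods inside \<open>U\<close>. The
  quotient map is open, so finitely many of their images cover \<open>L\<close>.\<close>

lemma compactin_coset_lift:
  fixes U :: "'g::{topological_group_add, t2_space} set"
  assumes lc: "locally_compact_space (euclidean :: 'g topology)" and H: "add_subgroup H"
    and U: "open U" and L: "compactin (coset_topology H) L" "L \<subseteq> left_coset H ` U"
  obtains K where "compact K" "K \<subseteq> U" "L \<subseteq> left_coset H ` K"
proof -
  let ?\<O> = "{O'. open O' \<and> (\<exists>K. compact K \<and> O' \<subseteq> K \<and> K \<subseteq> U)}"
  have "L \<subseteq> \<Union> ((`) (left_coset H) ` ?\<O>)"
  proof
    fix l assume "l \<in> L"
    with L(2) obtain u where u: "u \<in> U" "l = left_coset H u" by auto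
    obtain O' K where "open O'" "compact K" "u \<in> O'" "O' \<subseteq> K" "K \<subseteq> U"
      by (rule locally_compact_t2_compact_neighbourhood[OF lc U u(1)])
    then show "l \<in> \<Union> ((`) (left_coset H) ` ?\<O>)"
      unfolding u(2) by (intro UnionI[of "left_coset H ` O'"] imageI CollectI conjI exI[of _ K])
  qed
  moreover have "openin (coset_topology H) V" if "V \<in> (`) (left_coset H) ` ?\<O>" for V
    using that openin_left_coset_image[OF H] by blast
  ultimately obtain \<F> where F: "finite \<F>" "\<F> \<subseteq> (`) (left_coset H) ` ?\<O>" "L \<subseteq> \<Union>\<F>"
    using compactinD[OF L(1), of "(`) (left_coset H) ` ?\<O>"] by blast
  then obtain \<G> where G: "\<G> \<subseteq> ?\<O>" "finite \<G>" "\<F> = (`) (left_coset H) ` \<G>"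
    using finite_subset_image[OF F(1,2)] by blast
  have "\<forall>O'\<in>\<G>. \<exists>K. compact K \<and> O' \<subseteq> K \<and> K \<subseteq> U" using G(1) by blast
  then obtain k where k: "\<And>O'. O' \<in> \<G> \<Longrightarrow> compact (k O') \<and> O' \<subseteq> k O' \<and> k O' \<subseteq> U" by metis
  show ?thesis
  proof (rule that[of "\<Union>O'\<in>\<G>. k O'"])
    show "compact (\<Union>O'\<in>\<G>. k O')" using G(2) k by (intro compact_UN) auto
    show "(\<Union>O'\<in>\<G>. k O') \<subseteq> U" using k by blast
    show "L \<subseteq> left_coset H ` (\<Union>O'\<in>\<G>. k O')" using F(3) k unfolding G(3) by blast
  qed
qed

section \<open>The invariant measure on the cosets and its comparison with Haar measure\<close>

lemma invariant_probability_radon: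
  "invariant_probability_on_cosets H \<nu> \<Longrightarrow> radon_measure (coset_topology H) \<nu>"
  by (simp add: invariant_probability_on_cosets_def)

lemma space_invariant_probability:
  "invariant_probability_on_cosets H \<nu> \<Longrightarrow> space \<nu> = range (left_coset H)"
  by (simp add: invariant_probability_on_cosets_def radon_measure_def topspace_coset_topology)

lemma left_coset_image_in_sets:
  fixes U :: "'g::topological_group_add set"
  assumes "invariant_probability_on_cosets H \<nu>" "add_subgroup H" "open U"
  shows "left_coset H ` U \<in> sets \<nu>"
  using sets_radon_measure_open[OF invariant_probability_radon[OF assms(1)]
      openin_left_coset_image[OF assms(2,3)]] .

lemma emeasure_coset_translate:
  fixes U :: "'g::topological_group_add set"
  assumes \<nu>: "invariant_probability_on_cosets H \<nu>" and H: "add_subgroup H" and U: "open U"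
  shows "emeasure \<nu> (left_coset H ` (\<lambda>x. g + x) ` U) = emeasure \<nu> (left_coset H ` U)"
proof -
  have "(\<lambda>C. (\<lambda>x. g + x) ` C) ` left_coset H ` U = left_coset H ` (\<lambda>x. g + x) ` U"
    by (simp add: image_image translate_left_coset)
  then show ?thesis
    using \<nu> left_coset_image_in_sets[OF \<nu> H U] by (metis invariant_probability_on_cosets_def)
qed

text \<open>A discrete substitute for exchanging the integrals over \<open>x\<close> and \<open>y\<close> of the indicator function of
  \<open>{(x, y). x \<in> K, y \<in> x - Y + H}\<close>, which need not be measurable for the product of the Borel \<open>\<sigma>\<close>-algebras:
  \<open>x\<close> is rounded to one of finitely many centres, with an error in \<open>W\<close>.\<close>

lemma coset_average:
  fixes H :: "'g::{topological_group_add, t2_space} set"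
  assumes H: "add_subgroup H" and \<mu>: "haar_measure \<mu>"
    and \<nu>: "invariant_probability_on_cosets H \<nu>"
    and K: "compact K" and Y: "open Y" and W: "open W" "0 \<in> W"
  obtains F where "F \<in> borel_measurable \<nu>"
    "(\<integral>\<^sup>+ y. F y \<partial>\<nu>) = emeasure \<mu> K * emeasure \<nu> (left_coset H ` uminus ` Y)"
    "\<And>g. \<exists>E\<in>sets borel. F (left_coset H g) = emeasure \<mu> E \<and>
       (\<forall>x\<in>K. (\<forall>w\<in>W. \<exists>z\<in>Y. x - w = g + z) \<longrightarrow> x \<in> E) \<and>
       (\<forall>x\<in>E. x \<in> K \<and> (\<exists>h\<in>H. \<exists>w\<in>W. \<exists>z\<in>Y. x - w = g + h + z))"
proof -
  obtain n :: nat and x B where B: "\<And>i. B i \<in> sets borel" "disjoint_family B" "(\<Union>i<n. B i) = K"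
    and Bx: "\<And>i z. z \<in> B i \<Longrightarrow> \<exists>w\<in>W. z = x i + w"
    by (rule finite_borel_partition[OF K W]) blast
  \<comment> \<open>\<open>S i\<close> consists of the cosets of those \<open>g\<close> with
    \<open>x i\<close> in \<open>g + H + Y\<close>; by invariance its measure does not depend on
    \<open>i\<close>. \<open>F\<close> then measures the part of \<open>K\<close> whose centres
    qualify.\<close>
  define S where "S i = left_coset H ` (\<lambda>v. x i + v) ` uminus ` Y" for i
  define F where "F y = (\<Sum>i<n. emeasure \<mu> (B i) * indicator (S i) y)" for y
  have open_Y: "open (uminus ` Y)" by (rule open_uminus_image[OF Y])
  have S: "S i \<in> sets \<nu>" for i
    unfolding S_def by (intro left_coset_image_in_sets[OF \<nu> H] open_left_translate open_Y)
  have B\<mu>: "B i \<in> sets \<mu>" for i using B(1) by (simp add: sets_haar_measure[OF \<mu>])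
  have sum_B: "(\<Sum>i\<in>I. emeasure \<mu> (B i)) = emeasure \<mu> (\<Union>i\<in>I. B i)" if "finite I" for I
    using that B\<mu> B(2) by (intro sum_emeasure) (auto simp: disjoint_family_on_def)
  have mem_S: "left_coset H g \<in> S i \<longleftrightarrow> (\<exists>h\<in>H. \<exists>z\<in>Y. x i = g + h + z)" for g i
  proof -
    have "g + h \<in> (\<lambda>v. x i + v) ` uminus ` Y \<longleftrightarrow> (\<exists>z\<in>Y. x i = g + h + z)" for h
    proof -
      have "g + h = x i + - z \<longleftrightarrow> x i = g + h + z" for z
        by (metis add.assoc add.left_inverse add.right_inverse add.right_neutral)
      then show ?thesis by (simp only: image_image image_iff)
    qed
    then show ?thesis unfolding S_def mem_left_coset_image_iff[OF H] by simp
  qed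
  show ?thesis
  proof (rule that[of F])
    show "F \<in> borel_measurable \<nu>" unfolding F_def using S by measurable
    have "(\<integral>\<^sup>+ y. F y \<partial>\<nu>) = (\<Sum>i<n. emeasure \<mu> (B i) * emeasure \<nu> (S i))"
      unfolding F_def using S by (subst nn_integral_sum) (auto simp: nn_integral_cmult_indicator)
    also have "\<dots> = (\<Sum>i<n. emeasure \<mu> (B i)) * emeasure \<nu> (left_coset H ` uminus ` Y)"
      unfolding S_def emeasure_coset_translate[OF \<nu> H open_Y] by (simp add: sum_distrib_right)
    finally show "(\<integral>\<^sup>+ y. F y \<partial>\<nu>) = emeasure \<mu> K * emeasure \<nu> (left_coset H ` uminus ` Y)"
      by (simp add: sum_B B(3))
  next
    fix g
    define I where "I = {i. i < n \<and> left_coset H g \<in> S i}"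
    have fin: "finite I" by (simp add: I_def)
    show "\<exists>E\<in>sets borel. F (left_coset H g) = emeasure \<mu> E \<and>
       (\<forall>x\<in>K. (\<forall>w\<in>W. \<exists>z\<in>Y. x - w = g + z) \<longrightarrow> x \<in> E) \<and>
       (\<forall>x\<in>E. x \<in> K \<and> (\<exists>h\<in>H. \<exists>w\<in>W. \<exists>z\<in>Y. x - w = g + h + z))"
    proof (intro bexI[of _ "\<Union>i\<in>I. B i"] conjI ballI impI)
      have "F (left_coset H g) = (\<Sum>i<n. if left_coset H g \<in> S i then emeasure \<mu> (B i) else 0)"
        unfolding F_def by (intro sum.cong) auto
      also have "\<dots> = (\<Sum>i\<in>I. emeasure \<mu> (B i))"
        unfolding I_def by (subst sum.inter_filter[symmetric]) auto
      finally show "F (left_coset H g) = emeasure \<mu> (\<Union>i\<in>I. B i)" using sum_B[OF fin] by simp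
    next
      fix a assume a: "a \<in> K" "\<forall>w\<in>W. \<exists>z\<in>Y. a - w = g + z"
      then obtain i where i: "i < n" "a \<in> B i" using B(3) by blast
      then obtain w where w: "w \<in> W" "a = x i + w" using Bx by blast
      then obtain z where "z \<in> Y" "a - w = g + z" using a(2) by blast
      then have "x i = g + 0 + z" using w(2) by simp
      moreover have "0 \<in> H" using H by (simp add: add_subgroup_def)
      ultimately have "left_coset H g \<in> S i" unfolding mem_S using \<open>z \<in> Y\<close> by blast
      then show "a \<in> (\<Union>i\<in>I. B i)" using i by (auto simp: I_def)
    next
      fix a assume "a \<in> (\<Union>i\<in>I. B i)"
      then obtain i where i: "i < n" "left_coset H g \<in> S i" "a \<in> B i" by (auto simp: I_def)
      then show "a \<in> K" using B(3) by blast
      obtain w where w: "w \<in> W" "a = x i + w" using Bx i(3) by blast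
      obtain h z where "h \<in> H" "z \<in> Y" "x i = g + h + z" using i(2) mem_S by blast
      moreover have "a - w = x i" using w(2) by simp
      ultimately show "\<exists>h\<in>H. \<exists>w\<in>W. \<exists>z\<in>Y. a - w = g + h + z" using w(1) by auto
    next
      show "(\<Union>i\<in>I. B i) \<in> sets borel" using fin B(1) by auto
    qed
  qed
qed

text \<open>Let \<open>q\<close> be the measure of the image of \<open>- Y2\<close>, where \<open>Y1 \<subseteq> Y2 \<subseteq> Y3\<close> are small neighbourhoods of \<open>0\<close>.
  Averaging over a compact subset of \<open>U\<close> bounds the measure of the image of \<open>U\<close> by \<open>\<mu> U * q / \<mu> Y1\<close>;
  averaging over the fixed compact set \<open>K0\<close> bounds \<open>q\<close> by \<open>N * \<mu> Y3 / \<mu> K0\<close>, as a coset has at most \<open>N\<close>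
  relevant points. Outer regularity gives \<open>\<mu> Y3 \<le> 2 * \<mu> Y1\<close>, so the constant does not depend on \<open>U\<close>.\<close>

lemma coset_measure_open_le:
  fixes H :: "'g::{topological_group_add, t2_space} set"
  assumes lc: "locally_compact_space (euclidean :: 'g topology)"
    and H: "add_subgroup H" "closed H" "discrete H" and \<mu>: "haar_measure \<mu>"
    and \<nu>: "invariant_probability_on_cosets H \<nu>"
  obtains C where "C < (\<infinity>::ennreal)"
    "\<And>U. open U \<Longrightarrow> emeasure \<nu> (left_coset H ` U) \<le> C * emeasure \<mu> U"
proof -
  have compact_fin: "emeasure \<mu> K < \<infinity>" if "compact K" for K
    using \<mu> that by (simp add: haar_measure_def radon_measure_def)
  have borel: "A \<in> sets \<mu>" if "A \<in> sets borel" for A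
    using that by (simp add: sets_haar_measure[OF \<mu>])
  obtain O0 K0 :: "'g set" where K0: "open O0" "compact K0" "0 \<in> O0" "O0 \<subseteq> K0"
    using locally_compact_t2_compact_neighbourhood[OF lc open_UNIV UNIV_I[of 0]] by metis
  define m0 where "m0 = emeasure \<mu> K0"
  have K0_sets: "K0 \<in> sets \<mu>" by (intro borel borel_closed compact_imp_closed K0)
  have "emeasure \<mu> O0 \<noteq> 0" using K0 by (intro emeasure_haar_open_pos[OF \<mu>]) auto
  then have m0: "m0 \<noteq> 0" "m0 \<noteq> top"
    using emeasure_mono[OF K0(4) K0_sets] compact_fin[OF K0(2)] by (auto simp: m0_def)
  \<comment> \<open>If \<open>g + h + Y3\<close> meets \<open>K0\<close>, then \<open>g + h\<close>
    lies in \<open>K0 - K0 = M\<close>, since \<open>Y3\<close> lies in \<open>K0\<close>. Two such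
    \<open>h\<close> differ by an element of \<open>- M + M = D\<close>, so \<open>N\<close> bounds
    their number for every \<open>g\<close>.\<close>
  define M where "M = (\<lambda>(x, y). x + y) ` (K0 \<times> uminus ` K0)"
  define D where "D = (\<lambda>(x, y). x + y) ` (uminus ` M \<times> M)"
  have "compact D"
    unfolding D_def M_def by (intro compact_set_add compact_uminus_image K0)
  then have finD: "finite (H \<inter> D)" by (rule finite_closed_discrete_Int_compact[OF H(2,3)])
  define N where "N = card (H \<inter> D)"
  \<comment> \<open>The factor 2 is the loss from \<open>Y1\<close> to \<open>Y3\<close>;
    \<open>N / m0\<close> comes from averaging over \<open>K0\<close>.\<close>
  define C where "C = 2 * of_nat N / m0"
  have compact_le: "emeasure \<nu> L \<le> C * emeasure \<mu> U"
    if U: "open U" and L: "compactin (coset_topology H) L" "L \<subseteq> left_coset H ` U" for U L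
  proof (cases "L \<in> sets \<nu>")
    case L_sets: True
    obtain K where K: "compact K" "K \<subseteq> U" "L \<subseteq> left_coset H ` K"
      by (rule compactin_coset_lift[OF lc H(1) U L])
    obtain V0 where V0: "open V0" "0 \<in> V0" "\<And>x v. x \<in> K \<Longrightarrow> v \<in> V0 \<Longrightarrow> x + v \<in> U"
      by (rule compact_add_zero_neighbourhood[OF K(1) U K(2)]) blast
    have "open (V0 \<inter> O0)" "0 \<in> V0 \<inter> O0" using V0 K0 by auto
    from locally_compact_t2_compact_neighbourhood[OF lc this]
    obtain O1 Y1 where Y1: "open O1" "compact Y1" "0 \<in> O1" "O1 \<subseteq> Y1" "Y1 \<subseteq> V0 \<inter> O0" by metis
    have Y1_borel: "Y1 \<in> sets borel" by (intro borel_closed compact_imp_closed Y1)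
    have "emeasure \<mu> O1 \<noteq> 0" using Y1 by (intro emeasure_haar_open_pos[OF \<mu>]) auto
    then have y1: "emeasure \<mu> Y1 \<noteq> 0" "emeasure \<mu> Y1 \<noteq> top"
      using emeasure_mono[OF Y1(4) borel[OF Y1_borel]] compact_fin[OF Y1(2)] by auto
    have "emeasure \<mu> Y1 < 2 * emeasure \<mu> Y1"
      using y1 ennreal_add_left_cancel_less[of "emeasure \<mu> Y1" 0 "emeasure \<mu> Y1"]
      by (simp add: mult_2 zero_less_iff_neq_zero)
    moreover have "emeasure \<mu> Y1 = (INF V\<in>{V. openin euclidean V \<and> Y1 \<subseteq> V}. emeasure \<mu> V)"
      using \<mu> borel[OF Y1_borel] unfolding haar_measure_def radon_measure_def by blast
    ultimately obtain Y3' where Y3': "open Y3'" "Y1 \<subseteq> Y3'" "emeasure \<mu> Y3' < 2 * emeasure \<mu> Y1"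
      by (auto simp: INF_less_iff)
    define Y3 where "Y3 = Y3' \<inter> O0"
    have Y3: "open Y3" "Y1 \<subseteq> Y3" "Y3 \<subseteq> K0" using Y3' Y1 K0 by (auto simp: Y3_def)
    have Y3_borel: "Y3 \<in> sets borel" using Y3(1) by simp
    have "emeasure \<mu> Y3 \<le> emeasure \<mu> Y3'"
      using Y3'(1) by (intro emeasure_mono borel) (auto simp: Y3_def)
    then have y3: "emeasure \<mu> Y3 \<le> 2 * emeasure \<mu> Y1" using Y3'(3) by simp
    obtain V where V: "open V" "0 \<in> V" "\<And>x v. x \<in> Y1 \<Longrightarrow> v \<in> V \<Longrightarrow> x + v \<in> Y3"
      by (rule compact_add_zero_neighbourhood[OF Y1(2) Y3(1,2)]) blast
    obtain W where W: "open W" "0 \<in> W" "\<And>w w'. w \<in> W \<Longrightarrow> w' \<in> W \<Longrightarrow> - w + w' \<in> V"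
      by (rule zero_neighbourhood_diff[OF V(1,2)]) blast
    \<comment> \<open>\<open>Y2 = Y1 - W\<close> absorbs the rounding error in both estimates:
      \<open>Y1 - W\<close> stays in \<open>Y2\<close> for the lower one, and \<open>Y2 + W\<close>
      stays in \<open>Y1 + V\<close>, hence in \<open>Y3\<close>, for the upper one.\<close>
    define Y2 where "Y2 = (\<Union>y\<in>Y1. (\<lambda>x. y + x) ` uminus ` W)"
    have Y2: "open Y2"
      unfolding Y2_def by (intro open_UN ballI open_left_translate open_uminus_image W)
    define q where "q = emeasure \<nu> (left_coset H ` uminus ` Y2)"
    have I: "emeasure \<mu> Y1 * emeasure \<nu> L \<le> emeasure \<mu> U * q"
    proof -
      define K1 where "K1 = (\<lambda>(x, y). x + y) ` (K \<times> Y1)"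
      have K1: "compact K1" unfolding K1_def by (intro compact_set_add K Y1)
      have "K1 \<subseteq> U" using V0(3) Y1(5) by (auto simp: K1_def)
      then have K1_le: "emeasure \<mu> K1 \<le> emeasure \<mu> U"
        using U by (intro emeasure_mono borel) auto
      obtain F where F: "F \<in> borel_measurable \<nu>" "(\<integral>\<^sup>+ y. F y \<partial>\<nu>) = emeasure \<mu> K1 * q"
        "\<And>g. \<exists>E\<in>sets borel. F (left_coset H g) = emeasure \<mu> E \<and>
           (\<forall>x\<in>K1. (\<forall>w\<in>W. \<exists>z\<in>Y2. x - w = g + z) \<longrightarrow> x \<in> E) \<and>
           (\<forall>x\<in>E. x \<in> K1 \<and> (\<exists>h\<in>H. \<exists>w\<in>W. \<exists>z\<in>Y2. x - w = g + h + z))"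
        using coset_average[OF H(1) \<mu> \<nu> K1 Y2 W(1,2)] unfolding q_def by blast
      \<comment> \<open>For a representative \<open>g\<close> in \<open>K\<close>, the whole
        translate \<open>g + Y1\<close> lies in \<open>K1\<close> and is counted by
        \<open>F\<close>.\<close>
      have F_ge: "emeasure \<mu> Y1 \<le> F l" if l: "l \<in> L" for l
      proof -
        obtain g where g: "g \<in> K" "l = left_coset H g" using K(3) l by blast
        obtain E where E: "E \<in> sets borel" "F (left_coset H g) = emeasure \<mu> E"
          and E_mem: "\<forall>x\<in>K1. (\<forall>w\<in>W. \<exists>z\<in>Y2. x - w = g + z) \<longrightarrow> x \<in> E"
          using F(3)[of g] by (elim bexE conjE)
        have "g + y \<in> E" if y: "y \<in> Y1" for y
        proof (rule E_mem[rule_format])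
          show "g + y \<in> K1" using g(1) y by (auto simp: K1_def)
          show "\<exists>z\<in>Y2. g + y - w = g + z" if "w \<in> W" for w
          proof (rule bexI)
            show "g + y - w = g + (y + - w)" by (simp only: diff_conv_add_uminus add.assoc)
            show "y + - w \<in> Y2" unfolding Y2_def using y that by blast
          qed
        qed
        then have "emeasure \<mu> ((\<lambda>x. g + x) ` Y1) \<le> emeasure \<mu> E"
          by (intro emeasure_mono borel E(1)) blast
        then show ?thesis using E(2) g(2) by (simp add: emeasure_haar_translate[OF \<mu> Y1_borel])
      qed
      have "emeasure \<mu> Y1 * emeasure \<nu> L = (\<integral>\<^sup>+ y. emeasure \<mu> Y1 * indicator L y \<partial>\<nu>)"
        using L_sets by (simp add: nn_integral_cmult_indicator)
      also have "\<dots> \<le> (\<integral>\<^sup>+ y. F y \<partial>\<nu>)"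
        by (intro nn_integral_mono) (auto simp: indicator_def F_ge)
      also have "\<dots> \<le> emeasure \<mu> U * q" unfolding F(2) by (rule mult_right_mono[OF K1_le]) simp
      finally show ?thesis .
    qed
    have II: "m0 * q \<le> of_nat N * emeasure \<mu> Y3"
    proof -
      obtain F where F: "F \<in> borel_measurable \<nu>" "(\<integral>\<^sup>+ y. F y \<partial>\<nu>) = emeasure \<mu> K0 * q"
        "\<And>g. \<exists>E\<in>sets borel. F (left_coset H g) = emeasure \<mu> E \<and>
           (\<forall>x\<in>K0. (\<forall>w\<in>W. \<exists>z\<in>Y2. x - w = g + z) \<longrightarrow> x \<in> E) \<and>
           (\<forall>x\<in>E. x \<in> K0 \<and> (\<exists>h\<in>H. \<exists>w\<in>W. \<exists>z\<in>Y2. x - w = g + h + z))"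
        using coset_average[OF H(1) \<mu> \<nu> K0(2) Y2 W(1,2)] unfolding q_def by blast
      have F_le: "F (left_coset H g) \<le> of_nat N * emeasure \<mu> Y3" for g
      proof -
        obtain E where E: "E \<in> sets borel" "F (left_coset H g) = emeasure \<mu> E"
          and E_mem: "\<forall>x\<in>E. x \<in> K0 \<and> (\<exists>h\<in>H. \<exists>w\<in>W. \<exists>z\<in>Y2. x - w = g + h + z)"
          using F(3)[of g] by (elim bexE conjE)
        define J where "J = {h\<in>H. \<exists>x\<in>K0. \<exists>z\<in>Y3. x = g + h + z}"
        have EJ: "E \<subseteq> (\<Union>h\<in>J. (\<lambda>x. (g + h) + x) ` Y3)"
        proof
          fix x assume x: "x \<in> E"
          obtain h w z where h: "h \<in> H" "w \<in> W" "z \<in> Y2" "x - w = g + h + z" using bspec[OF E_mem x] by blast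
          obtain y w' where y: "y \<in> Y1" "w' \<in> W" "z = y + - w'" using h(3) unfolding Y2_def by blast
          have "x = (x - w) + w" by simp
          also have "\<dots> = g + h + (y + (- w' + w))" unfolding h(4) y(3) by (simp only: add.assoc)
          finally have xe: "x = g + h + (y + (- w' + w))" .
          have "y + (- w' + w) \<in> Y3" using V(3)[OF y(1) W(3)[OF y(2) h(2)]] .
          moreover from this have "h \<in> J" unfolding J_def using h(1) xe bspec[OF E_mem x] by blast
          ultimately show "x \<in> (\<Union>h\<in>J. (\<lambda>x. (g + h) + x) ` Y3)" using xe by blast
        qed
        have JM: "g + h \<in> M" if "h \<in> J" for h
        proof -
          from that have "\<exists>x\<in>K0. \<exists>z\<in>Y3. x = g + h + z" by (simp only: J_def mem_Collect_eq)
          then obtain x z where "x \<in> K0" "z \<in> Y3" "x = g + h + z" by (elim bexE)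
          then have "g + h = x + - z" by simp
          then show ?thesis unfolding M_def using \<open>x \<in> K0\<close> \<open>z \<in> Y3\<close> Y3(3) by force
        qed
        have J: "finite J \<and> card J \<le> N"
        proof (cases "J = {}")
          case False
          then obtain h0 where h0: "h0 \<in> J" by blast
          have "J \<subseteq> (\<lambda>d. h0 + d) ` (H \<inter> D)"
          proof
            fix h assume h: "h \<in> J"
            have "- h0 + h = - (g + h0) + (g + h)" by (simp only: minus_add add.assoc minus_add_cancel)
            then have "- h0 + h \<in> D" unfolding D_def using JM[OF h] JM[OF h0] by force
            moreover have "- h0 + h \<in> H" using h h0 H(1) by (simp add: J_def add_subgroup_def)
            ultimately show "h \<in> (\<lambda>d. h0 + d) ` (H \<inter> D)"
              by (intro image_eqI[of _ _ "- h0 + h"]) simp_all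
          qed
          then show ?thesis
            using finD surj_card_le[of "H \<inter> D" J] finite_surj by (auto simp: N_def)
        qed simp
        have tr: "(\<lambda>x. (g + h) + x) ` Y3 \<in> sets \<mu>" for h
          by (intro borel borel_open open_left_translate Y3)
        have "emeasure \<mu> E \<le> emeasure \<mu> (\<Union>h\<in>J. (\<lambda>x. (g + h) + x) ` Y3)"
          using J by (intro emeasure_mono[OF EJ] sets.finite_UN tr) simp
        also have "\<dots> \<le> (\<Sum>h\<in>J. emeasure \<mu> ((\<lambda>x. (g + h) + x) ` Y3))"
          using J by (intro emeasure_subadditive_finite image_subsetI tr) simp
        also have "\<dots> = of_nat (card J) * emeasure \<mu> Y3"
          by (simp add: emeasure_haar_translate[OF \<mu> Y3_borel])
        also have "\<dots> \<le> of_nat N * emeasure \<mu> Y3" using J by (intro mult_right_mono) auto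
        finally show ?thesis using E(2) by simp
      qed
      have "m0 * q = (\<integral>\<^sup>+ y. F y \<partial>\<nu>)" by (simp add: m0_def F(2))
      also have "\<dots> \<le> (\<integral>\<^sup>+ y. of_nat N * emeasure \<mu> Y3 \<partial>\<nu>)"
        using F_le by (intro nn_integral_mono) (auto simp: space_invariant_probability[OF \<nu>])
      also have "\<dots> = of_nat N * emeasure \<mu> Y3"
        using \<nu> by (simp add: invariant_probability_on_cosets_def)
      finally show ?thesis .
    qed
    have "emeasure \<mu> Y1 * (emeasure \<nu> L * m0) \<le> emeasure \<mu> U * (m0 * q)"
      using mult_right_mono[OF I, of m0] by (simp add: mult_ac)
    also have "\<dots> \<le> emeasure \<mu> U * (of_nat N * (2 * emeasure \<mu> Y1))"
      using II mult_left_mono[OF y3, of "of_nat N"] by (intro mult_left_mono) (auto intro: order_trans)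
    also have "\<dots> = emeasure \<mu> Y1 * (2 * of_nat N * emeasure \<mu> U)" by (simp add: mult_ac)
    finally have "emeasure \<nu> L * m0 \<le> 2 * of_nat N * emeasure \<mu> U"
      using y1 by (simp add: ennreal_mult_le_mult_iff)
    then have "emeasure \<nu> L * m0 / m0 \<le> 2 * of_nat N * emeasure \<mu> U / m0"
      by (rule divide_right_mono_ennreal)
    then have "emeasure \<nu> L \<le> 2 * of_nat N * emeasure \<mu> U / m0"
      unfolding ennreal_mult_divide_eq[OF m0] .
    then show ?thesis by (simp add: C_def ennreal_times_divide mult_ac)
  \<comment> \<open>A compact \<open>L\<close> outside \<open>sets \<nu>\<close> has
    \<open>emeasure\<close> 0 by default.\<close>
  qed (simp add: emeasure_notin_sets)
  have "emeasure \<nu> (left_coset H ` U) \<le> C * emeasure \<mu> U" if "open U" for U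
  proof -
    have "emeasure \<nu> (left_coset H ` U)
        = (SUP L\<in>{L. compactin (coset_topology H) L \<and> L \<subseteq> left_coset H ` U}. emeasure \<nu> L)"
      using invariant_probability_radon[OF \<nu>] openin_left_coset_image[OF H(1) that]
      unfolding radon_measure_def by blast
    then show ?thesis using compact_le[OF that] by (auto intro!: SUP_least)
  qed
  moreover have "C < \<infinity>"
    using m0 by (simp add: C_def less_top[symmetric] ennreal_divide_eq_top_iff ennreal_mult_eq_top_iff)
  ultimately show ?thesis using that by blast
qed

lemma left_coset_measurable:
  fixes H :: "'g::{topological_group_add, t2_space} set"
  assumes \<mu>: "haar_measure \<mu>" and \<nu>: "invariant_probability_on_cosets H \<nu>"
  shows "left_coset H \<in> measurable \<mu> \<nu>"
proof (rule measurable_sigma_sets)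
  show "sets \<nu> = sigma_sets (topspace (coset_topology H)) {U. openin (coset_topology H) U}"
    using invariant_probability_radon[OF \<nu>] by (simp add: radon_measure_def)
  show "{U. openin (coset_topology H) U} \<subseteq> Pow (topspace (coset_topology H))"
    using openin_subset by blast
  show "left_coset H \<in> space \<mu> \<rightarrow> topspace (coset_topology H)" by (auto simp: topspace_coset_topology)
  show "left_coset H -` U \<inter> space \<mu> \<in> sets \<mu>" if "U \<in> {U. openin (coset_topology H) U}" for U
    using that sets_haar_measure[OF \<mu>] sets_eq_imp_space_eq[OF sets_haar_measure[OF \<mu>]]
    by (auto simp: openin_coset_topology)
qed

lemma fundamental_domain_meets_coset:
  assumes "fundamental_domain H \<Omega>" "add_subgroup H"
  shows "\<exists>x\<in>\<Omega>. left_coset H x = left_coset H g"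
proof -
  have "g \<in> (\<lambda>(x, h). x + h) ` (\<Omega> \<times> H)"
    using assms(1) unfolding fundamental_domain_def bij_betw_def by simp
  then obtain x h where x: "x \<in> \<Omega>" "h \<in> H" "g = x + h" by auto
  then have "left_coset H x \<in> left_coset H ` {g}"
    unfolding mem_left_coset_image_iff[OF assms(2)] by blast
  then show ?thesis using x(1) by blast
qed

text \<open>Only this inequality between the two measures is needed, and it also holds when
  \<open>H\<close> is uncountable, in which case \<open>\<Omega>\<close> may have infinite measure.\<close>

lemma nn_integral_coset_le_fundamental_domain:
  fixes H :: "'g::{topological_group_add, t2_space} set"
  assumes lc: "locally_compact_space (euclidean :: 'g topology)"
    and H: "add_subgroup H" "closed H" "discrete H" and \<mu>: "haar_measure \<mu>"
    and \<nu>: "invariant_probability_on_cosets H \<nu>" and \<Omega>: "fundamental_domain H \<Omega>"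
  obtains C where "C < (\<infinity>::ennreal)"
    "\<And>f. f \<in> borel_measurable \<nu> \<Longrightarrow>
       (\<integral>\<^sup>+ y. f y \<partial>\<nu>) \<le> C * (\<integral>\<^sup>+ x\<in>\<Omega>. f (left_coset H x) \<partial>\<mu>)"
proof -
  obtain C where C: "C < \<infinity>"
    and C_le: "\<And>U. open U \<Longrightarrow> emeasure \<nu> (left_coset H ` U) \<le> C * emeasure \<mu> U"
    by (rule coset_measure_open_le[OF lc H \<mu> \<nu>]) blast
  note meas = left_coset_measurable[OF \<mu> \<nu>]
  have \<Omega>_sets: "\<Omega> \<in> sets \<mu>"
    using \<Omega> by (simp add: fundamental_domain_def sets_haar_measure[OF \<mu>])
  \<comment> \<open>The Haar measure on \<Omega>, pushed to the cosets. Comparing it with \<nu> on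
    sets gives the inequality for all integrands at once.\<close>
  define \<rho> where "\<rho> = distr (density \<mu> (indicator \<Omega>)) \<nu> (left_coset H)"
  have sets_\<rho>: "sets \<rho> = sets \<nu>" by (simp add: \<rho>_def)
  have int_\<rho>: "(\<integral>\<^sup>+ y. f y \<partial>\<rho>) = (\<integral>\<^sup>+ x\<in>\<Omega>. f (left_coset H x) \<partial>\<mu>)"
    if [measurable]: "f \<in> borel_measurable \<nu>" for f
  proof -
    have [measurable]: "left_coset H \<in> measurable \<mu> \<nu>" by (rule meas)
    have "(\<integral>\<^sup>+ y. f y \<partial>\<rho>) = (\<integral>\<^sup>+ x. f (left_coset H x) \<partial>density \<mu> (indicator \<Omega>))"
      unfolding \<rho>_def by (rule nn_integral_distr) (use meas that in auto)
    also have "\<dots> = (\<integral>\<^sup>+ x. indicator \<Omega> x * f (left_coset H x) \<partial>\<mu>)"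
      using \<Omega>_sets by (intro nn_integral_density) auto
    finally show ?thesis by (simp add: mult.commute)
  qed
  have "\<nu> \<le> scale_measure C \<rho>"
  proof (subst le_measure)
    show "sets \<nu> = sets (scale_measure C \<rho>)" by (simp add: sets_\<rho>)
    show "\<forall>B\<in>sets \<nu>. emeasure \<nu> B \<le> emeasure (scale_measure C \<rho>) B"
    proof
      fix B assume B: "B \<in> sets \<nu>"
      define E where "E = \<Omega> \<inter> (left_coset H -` B \<inter> space \<mu>)"
      have E: "E \<in> sets \<mu>" unfolding E_def using \<Omega>_sets measurable_sets[OF meas B] by blast
      have "emeasure \<rho> B = (\<integral>\<^sup>+ y. indicator B y \<partial>\<rho>)" using B by (simp add: sets_\<rho>)
      also have "\<dots> = (\<integral>\<^sup>+ x. indicator E x \<partial>\<mu>)"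
        using B by (subst int_\<rho>) (auto intro!: nn_integral_cong simp: E_def indicator_def)
      finally have \<rho>B: "emeasure \<rho> B = emeasure \<mu> E" using E by simp
      \<comment> \<open>Since \<Omega> meets every coset, \<open>E\<close> meets every coset in
        \<open>B\<close>, so the image of any open \<open>U\<close> around \<open>E\<close> contains
        \<open>B\<close>. Outer regularity of \<mu> then replaces \<open>U\<close> by
        \<open>E\<close>.\<close>
      have B_le: "emeasure \<nu> B \<le> C * emeasure \<mu> U" if U: "open U" "E \<subseteq> U" for U
      proof -
        have "B \<subseteq> left_coset H ` U"
        proof
          fix c assume c: "c \<in> B"
          then obtain g where "c = left_coset H g"
            using sets.sets_into_space[OF B] by (auto simp: space_invariant_probability[OF \<nu>])
          then obtain x where x: "x \<in> \<Omega>" "c = left_coset H x"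
            using fundamental_domain_meets_coset[OF \<Omega> H(1)] by metis
          have "space \<mu> = UNIV" using sets_eq_imp_space_eq[OF sets_haar_measure[OF \<mu>]] by simp
          then have "x \<in> E" using c x by (simp add: E_def)
          then show "c \<in> left_coset H ` U" using U(2) x(2) by blast
        qed
        then have "emeasure \<nu> B \<le> emeasure \<nu> (left_coset H ` U)"
          by (rule emeasure_mono) (rule left_coset_image_in_sets[OF \<nu> H(1) U(1)])
        also have "\<dots> \<le> C * emeasure \<mu> U" by (rule C_le[OF U(1)])
        finally show ?thesis .
      qed
      have "emeasure \<nu> B \<le> C * emeasure \<mu> E"
      proof (cases "C = 0")
        case True
        then show ?thesis using B_le[of UNIV] by simp
      next
        case False
        have C': "C \<noteq> top" using C by auto
        have "emeasure \<nu> B / C \<le> (INF U\<in>{U. openin euclidean U \<and> E \<subseteq> U}. emeasure \<mu> U)"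
        proof (rule INF_greatest)
          fix U assume "U \<in> {U. openin euclidean U \<and> E \<subseteq> U}"
          then have "emeasure \<nu> B \<le> emeasure \<mu> U * C" using B_le[of U] by (simp add: mult.commute)
          then have "emeasure \<nu> B / C \<le> emeasure \<mu> U * C / C" by (rule divide_right_mono_ennreal)
          then show "emeasure \<nu> B / C \<le> emeasure \<mu> U"
            unfolding ennreal_mult_divide_eq[OF False C'] .
        qed
        also have "\<dots> = emeasure \<mu> E"
          using \<mu> E unfolding haar_measure_def radon_measure_def by metis
        finally have "C * (emeasure \<nu> B / C) \<le> C * emeasure \<mu> E" by (rule mult_left_mono) simp
        moreover have "C * (emeasure \<nu> B / C) = emeasure \<nu> B"
          using ennreal_mult_divide_eq[OF False C', of "emeasure \<nu> B"]
          by (simp add: ennreal_times_divide mult.commute)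
        ultimately show ?thesis by simp
      qed
      then show "emeasure \<nu> B \<le> emeasure (scale_measure C \<rho>) B" by (simp add: \<rho>B)
    qed
  qed
  then have "(\<integral>\<^sup>+ y. f y \<partial>\<nu>) \<le> C * (\<integral>\<^sup>+ x\<in>\<Omega>. f (left_coset H x) \<partial>\<mu>)"
    if "f \<in> borel_measurable \<nu>" for f
  proof -
    have "(\<integral>\<^sup>+ y. f y \<partial>\<nu>) \<le> (\<integral>\<^sup>+ y. f y \<partial>scale_measure C \<rho>)"
      by (rule nn_integral_mono_measure) (simp_all add: sets_\<rho> \<open>\<nu> \<le> scale_measure C \<rho>\<close>)
    also have "\<dots> = C * (\<integral>\<^sup>+ y. f y \<partial>\<rho>)"
      using that measurable_cong_sets[OF sets_\<rho> refl] by (intro nn_integral_scale_measure) auto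
    finally show ?thesis by (simp only: int_\<rho>[OF that])
  qed
  then show ?thesis using C that by blast
qed

section \<open>Integrating \<open>H\<close>-invariant functions over the cosets\<close>

definition coset_rep :: "'g::group_add set \<Rightarrow> 'g set \<Rightarrow> 'g" where
  "coset_rep H C = (SOME g. left_coset H g = C)"

lemma left_coset_coset_rep: "left_coset H (coset_rep H (left_coset H g)) = left_coset H g"
  unfolding coset_rep_def by (rule someI[of _ g]) simp

text \<open>The choice behind \<open>coset_rep\<close> is arbitrary and carries no measurability;
  this makes it harmless for functions constant on cosets.\<close>

lemma coset_rep_invariant:
  assumes "add_subgroup H" "\<And>g h. h \<in> H \<Longrightarrow> F (g + h) = F g"
  shows "F (coset_rep H (left_coset H g)) = F g"
proof -
  have "left_coset H g \<in> left_coset H ` {coset_rep H (left_coset H g)}"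
    using left_coset_coset_rep[of H g] by force
  then obtain h where "h \<in> H" "coset_rep H (left_coset H g) = g + h"
    unfolding mem_left_coset_image_iff[OF assms(1)] by auto
  then show ?thesis using assms(2) by simp
qed

text \<open>The preimage of an open set is the image of an open subset of the group under the open
  quotient map.\<close>

lemma coset_rep_measurable:
  fixes F :: "'g::{topological_group_add, t2_space} \<Rightarrow> real"
  assumes H: "add_subgroup H" and \<nu>: "invariant_probability_on_cosets H \<nu>"
    and F: "\<And>g h. h \<in> H \<Longrightarrow> F (g + h) = F g" "continuous_on UNIV F"
  shows "(\<lambda>C. F (coset_rep H C)) \<in> borel_measurable \<nu>"
proof (rule borel_measurableI)
  fix U :: "real set" assume U: "open U"
  have inv: "F (coset_rep H (left_coset H g)) = F g" for g
    by (rule coset_rep_invariant[OF H]) (rule F(1))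
  have "(\<lambda>C. F (coset_rep H C)) -` U \<inter> space \<nu> = left_coset H ` (F -` U)"
  proof (intro equalityI subsetI)
    fix C assume "C \<in> (\<lambda>C. F (coset_rep H C)) -` U \<inter> space \<nu>"
    then obtain g where "C = left_coset H g" "F (coset_rep H C) \<in> U"
      by (auto simp: space_invariant_probability[OF \<nu>])
    then show "C \<in> left_coset H ` (F -` U)" using inv[of g] by auto
  next
    fix C assume "C \<in> left_coset H ` (F -` U)"
    then obtain g where "C = left_coset H g" "F g \<in> U" by blast
    then show "C \<in> (\<lambda>C. F (coset_rep H C)) -` U \<inter> space \<nu>"
      using inv[of g] by (simp add: space_invariant_probability[OF \<nu>])
  qed
  moreover have "open (F -` U)" using F(2) U by (simp add: continuous_on_open_vimage)
  ultimately show "(\<lambda>C. F (coset_rep H C)) -` U \<inter> space \<nu> \<in> sets \<nu>"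
    using left_coset_image_in_sets[OF \<nu> H] by simp
qed

lemma emeasure_coset_open_pos:
  fixes U :: "'g::{topological_group_add, t2_space} set"
  assumes H: "add_subgroup H" and \<nu>: "invariant_probability_on_cosets H \<nu>"
    and U: "open U" "U \<noteq> {}"
  shows "emeasure \<nu> (left_coset H ` U) \<noteq> 0"
proof
  assume 0: "emeasure \<nu> (left_coset H ` U) = 0"
  obtain u where u: "u \<in> U" using U(2) by blast
  have "emeasure \<nu> (topspace (coset_topology H)) = 0"
  proof (rule radon_measure_null_cover[OF invariant_probability_radon[OF \<nu>]])
    show "topspace (coset_topology H) \<subseteq> \<Union> (range (\<lambda>g. left_coset H ` (\<lambda>x. g + x) ` U))"
    proof
      fix C assume "C \<in> topspace (coset_topology H)"
      then obtain x where "C = left_coset H x" by (auto simp: topspace_coset_topology)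
      then have "C = left_coset H ((x - u) + u)" by simp
      then show "C \<in> \<Union> (range (\<lambda>g. left_coset H ` (\<lambda>x. g + x) ` U))" using u by blast
    qed
    fix V assume "V \<in> range (\<lambda>g. left_coset H ` (\<lambda>x. g + x) ` U)"
    then obtain g where V: "V = left_coset H ` (\<lambda>x. g + x) ` U" by blast
    show "openin (coset_topology H) V \<and> emeasure \<nu> V = 0"
      unfolding V emeasure_coset_translate[OF \<nu> H U(1)]
      using 0 openin_left_coset_image[OF H open_left_translate[OF U(1)]] by simp
  qed
  then have "emeasure \<nu> (space \<nu>) = 0"
    unfolding space_invariant_probability[OF \<nu>] topspace_coset_topology .
  then show False using \<nu> by (simp add: invariant_probability_on_cosets_def)
qed

text \<open>\<open>F (k + coset_rep H C)\<close> is the value at the translated coset. Invariance of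
  \<nu> is given for images of sets; as translation by \<open>- k\<close> is inverse to translation
  by \<open>k\<close>, it also holds for preimages, hence for the push-forward.\<close>

lemma integral_coset_translate:
  fixes F :: "'g::{topological_group_add, t2_space} \<Rightarrow> real"
  assumes H: "add_subgroup H" and \<nu>: "invariant_probability_on_cosets H \<nu>"
    and F: "\<And>g h. h \<in> H \<Longrightarrow> F (g + h) = F g" "continuous_on UNIV F"
  shows "(\<integral>C. F (k + coset_rep H C) \<partial>\<nu>) = (\<integral>C. F (coset_rep H C) \<partial>\<nu>)"
proof -
  let ?act = "\<lambda>(g::'g) C. (\<lambda>x. g + x) ` C"
  have inv: "F (coset_rep H (left_coset H g)) = F g" for g
    by (rule coset_rep_invariant[OF H]) (rule F(1))
  note sp = space_invariant_probability[OF \<nu>]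
  have act_sp: "?act g C \<in> space \<nu>" if "C \<in> space \<nu>" for g C
    using that by (auto simp: sp translate_left_coset)
  have act_add: "?act g (?act g' C) = ?act (g + g') C" for g g' C
    unfolding image_image by (intro image_cong refl) (simp only: add.assoc)
  have act_meas: "?act g \<in> measurable \<nu> \<nu>" for g
  proof (rule measurable_sigma_sets)
    show "sets \<nu> = sigma_sets (topspace (coset_topology H)) {U. openin (coset_topology H) U}"
      using invariant_probability_radon[OF \<nu>] unfolding radon_measure_def by (elim conjE)
    show "{U. openin (coset_topology H) U} \<subseteq> Pow (topspace (coset_topology H))"
      using openin_subset by blast
    show "?act g \<in> space \<nu> \<rightarrow> topspace (coset_topology H)"
      using act_sp by (auto simp: sp topspace_coset_topology)
    fix U assume "U \<in> {U. openin (coset_topology H) U}"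
    then have U: "open (left_coset H -` U)" by (simp add: openin_coset_topology)
    have "left_coset H -` (?act g -` U \<inter> space \<nu>) = (\<lambda>x. g + x) -` (left_coset H -` U)"
      by (auto simp: sp translate_left_coset)
    moreover have "open ((\<lambda>x. g + x) -` (left_coset H -` U))"
      using U by (intro open_vimage continuous_intros)
    ultimately have "openin (coset_topology H) (?act g -` U \<inter> space \<nu>)"
      by (simp add: openin_coset_topology sp)
    then show "?act g -` U \<inter> space \<nu> \<in> sets \<nu>"
      by (rule sets_radon_measure_open[OF invariant_probability_radon[OF \<nu>]])
  qed
  have "distr \<nu> \<nu> (?act k) = \<nu>"
  proof (rule measure_eqI)
    fix B assume "B \<in> sets (distr \<nu> \<nu> (?act k))"
    then have B: "B \<in> sets \<nu>" by simp
    let ?B = "?act k -` B \<inter> space \<nu>"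
    have "?act k ` ?B = B"
    proof (intro equalityI subsetI)
      fix C assume C: "C \<in> B"
      then have "?act (- k) C \<in> space \<nu>" using act_sp sets.sets_into_space[OF B] by blast
      moreover have "?act k (?act (- k) C) = C" unfolding act_add by simp
      ultimately show "C \<in> ?act k ` ?B"
        using C by (intro image_eqI[of _ _ "?act (- k) C"]) auto
    qed auto
    then have "emeasure \<nu> B = emeasure \<nu> ?B"
      using \<nu> measurable_sets[OF act_meas B] unfolding invariant_probability_on_cosets_def by metis
    then show "emeasure (distr \<nu> \<nu> (?act k)) B = emeasure \<nu> B"
      by (simp add: emeasure_distr[OF act_meas B])
  qed simp
  then have "(\<integral>C. F (coset_rep H C) \<partial>\<nu>) = (\<integral>C. F (coset_rep H C) \<partial>distr \<nu> \<nu> (?act k))" by simp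
  also have "\<dots> = (\<integral>C. F (coset_rep H (?act k C)) \<partial>\<nu>)"
    by (intro integral_distr act_meas coset_rep_measurable[OF H \<nu>] F)
  also have "\<dots> = (\<integral>C. F (k + coset_rep H C) \<partial>\<nu>)"
  proof (rule Bochner_Integration.integral_cong[OF refl])
    fix C assume "C \<in> space \<nu>"
    then obtain g where g: "C = left_coset H g" by (auto simp: sp)
    have "F (k + coset_rep H (left_coset H g)) = F (k + g)"
      by (rule coset_rep_invariant[where F = "\<lambda>g. F (k + g)", OF H])
        (simp add: F(1) add.assoc[symmetric])
    then show "F (coset_rep H (?act k C)) = F (k + coset_rep H C)"
      unfolding g translate_left_coset inv by simp
  qed
  finally show ?thesis by simp
qed

section \<open>Affine isometric actions\<close>

locale affine_isometric_action =
  fixes \<pi> :: "'g::{topological_group_add, t2_space} \<Rightarrow> 'h::complex_hilbert_space \<Rightarrow> 'h"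
    and b :: "'g \<Rightarrow> 'h" and \<alpha> :: "'g \<Rightarrow> 'h \<Rightarrow> 'h"
  assumes rep: "continuous_unitary_rep \<pi>" and cocycle: "continuous_cocycle \<pi> b"
    and action: "\<alpha> g v = \<pi> g v + b g"
begin

lemma rep_add: "\<pi> g (x + y) = \<pi> g x + \<pi> g y"
  and rep_scaleC: "\<pi> g (c *\<^sub>C x) = c *\<^sub>C \<pi> g x"
  and rep_zero_eq [simp]: "\<pi> 0 x = x"
  and rep_compose: "\<pi> (g + h) x = \<pi> g (\<pi> h x)"
  using rep by (simp_all add: continuous_unitary_rep_def unitary_def)

lemma rep_inner: "inner (\<pi> g x) (\<pi> g y) = inner x y"
  using rep by (simp add: continuous_unitary_rep_def unitary_def inner_eq_Re_cinner)

lemma rep_norm [simp]: "norm (\<pi> g x) = norm x"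
  by (simp add: norm_eq_sqrt_inner rep_inner)

lemma rep_bounded_linear: "bounded_linear (\<pi> g)"
  by (rule bounded_linear_intro[where K = 1]) (simp_all add: rep_add scaleR_scaleC rep_scaleC)

lemma rep_0: "\<pi> g 0 = 0"
  by (rule linear_0[OF bounded_linear.linear[OF rep_bounded_linear]])

lemma rep_diff: "\<pi> g (x - y) = \<pi> g x - \<pi> g y"
  by (rule linear_diff[OF bounded_linear.linear[OF rep_bounded_linear]])

lemma rep_minus_cancel [simp]: "\<pi> g (\<pi> (- g) x) = x" "\<pi> (- g) (\<pi> g x) = x"
  by (simp_all add: rep_compose[symmetric])

lemma rep_inner_left: "inner (\<pi> g x) y = inner x (\<pi> (- g) y)"
  using rep_inner[of g x "\<pi> (- g) y"] by simp

lemma cocycle_add: "b (g + h) = b g + \<pi> g (b h)"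
  using cocycle by (simp add: continuous_cocycle_def)

lemma cocycle_0: "b 0 = 0" using cocycle_add[of 0 0] by simp

lemma norm_cocycle_minus: "norm (b (- g)) = norm (b g)"
proof -
  have "b (- g) = - \<pi> (- g) (b g)"
    using cocycle_add[of "- g" g] by (simp add: cocycle_0 eq_neg_iff_add_eq_0)
  then show ?thesis by simp
qed

lemma action_compose: "\<alpha> (g + h) v = \<alpha> g (\<alpha> h v)"
  by (simp add: action rep_compose cocycle_add rep_add add_ac)

lemma action_diff: "\<alpha> g v - \<alpha> g w = \<pi> g (v - w)" by (simp add: action rep_diff)

text \<open>Strong continuity handles the fixed vector \<open>x g0\<close>; the remainder has the
  norm of \<open>x g - x g0\<close> because \<open>\<pi> g\<close> is isometric.\<close>

lemma continuous_on_rep: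
  assumes "continuous_on UNIV x"
  shows "continuous_on UNIV (\<lambda>g. \<pi> g (x g))"
  unfolding continuous_on_def
proof
  fix g0
  have x: "(x \<longlongrightarrow> x g0) (at g0)" using assms by (simp add: continuous_on_def)
  have "((\<lambda>g. \<pi> g (x g0)) \<longlongrightarrow> \<pi> g0 (x g0)) (at g0)"
    using rep by (simp add: continuous_unitary_rep_def continuous_on_def)
  moreover have "((\<lambda>g. \<pi> g (x g - x g0)) \<longlongrightarrow> 0) (at g0)"
  proof (rule tendsto_norm_zero_cancel)
    show "((\<lambda>g. norm (\<pi> g (x g - x g0))) \<longlongrightarrow> 0) (at g0)"
      unfolding rep_norm by (rule tendsto_norm_zero[OF LIM_zero[OF x]])
  qed
  ultimately have "((\<lambda>g. \<pi> g (x g0) + \<pi> g (x g - x g0)) \<longlongrightarrow> \<pi> g0 (x g0) + 0) (at g0)"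
    by (rule tendsto_add)
  then show "((\<lambda>g. \<pi> g (x g)) \<longlongrightarrow> \<pi> g0 (x g0)) (at g0)" by (simp add: rep_diff)
qed

lemma irreducible_imp_equivariant_trivial:
  assumes irr: "irreducible_on UNIV \<alpha>" and S: "positive_contraction S"
    and commute: "\<And>g x. S (\<pi> g x) = \<pi> g (S x)"
    and equi: "\<And>g v. S (\<alpha> g v) - c = \<pi> g (S v - c)"
  shows "S x = 0"
proof -
  interpret positive_contraction S by (rule S)
  have le: "norm (S (S x)) \<le> e * norm x" if e: "e > 0" for e
  proof -
    obtain v W where W: "complex_subspace W" "closed W" and v: "S v - c \<in> W"
      and W_inv: "\<And>F w. bounded_linear F \<Longrightarrow> (\<And>a x. F (a *\<^sub>C x) = a *\<^sub>C F x) \<Longrightarrow>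
        (\<And>x. F (S x) = S (F x)) \<Longrightarrow> w \<in> W \<Longrightarrow> F w \<in> W"
      and W_small: "\<And>x. (\<And>y. S y \<in> W) \<Longrightarrow> norm (S (S x)) \<le> e * norm x"
      by (rule spectral_subspace[OF e, of c]) blast
    define B where "B = {u. S u - c \<in> W}"
    have W_diff: "x - y \<in> W" if "x \<in> W" "y \<in> W" for x y
      using subspace_diff[OF complex_subspace_imp_subspace[OF W(1)] that] .
    have "closed B"
    proof -
      have "closed ((\<lambda>u. S u - c) -` W)"
        by (intro closed_vimage W(2) continuous_intros linear_continuous_on bounded_linear_S)
      then show ?thesis by (simp add: B_def vimage_def)
    qed
    moreover have "complex_affine B"
      unfolding complex_affine_def
    proof (intro ballI allI impI)
      fix x y and r s :: complex assume xy: "x \<in> B" "y \<in> B" and rs: "r + s = 1"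
      have "r *\<^sub>C c + s *\<^sub>C c = c" using rs by (simp add: scaleC_add_left[symmetric])
      then have "S (r *\<^sub>C x + s *\<^sub>C y) - c = S (r *\<^sub>C x + s *\<^sub>C y) - (r *\<^sub>C c + s *\<^sub>C c)" by simp
      also have "\<dots> = r *\<^sub>C (S x - c) + s *\<^sub>C (S y - c)"
        by (simp add: S.add S_scaleC scaleC_diff_right)
      also have "\<dots> \<in> W" using W(1) xy by (simp add: complex_subspace_def B_def)
      finally show "r *\<^sub>C x + s *\<^sub>C y \<in> B" by (simp add: B_def)
    qed
    moreover have "\<alpha> g ` B \<subseteq> B" for g
    proof (rule image_subsetI)
      fix u assume "u \<in> B"
      then have "S u - c \<in> W" by (simp add: B_def)
      with rep_scaleC commute[symmetric] have "\<pi> g (S u - c) \<in> W"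
        by (rule W_inv[of "\<pi> g", OF rep_bounded_linear])
      then show "\<alpha> g u \<in> B" by (simp add: B_def equi)
    qed
    moreover have "B \<noteq> {}" using v by (auto simp: B_def)
    ultimately have "B = UNIV" using irr unfolding irreducible_on_def by blast
    then have mem: "S u - c \<in> W" for u by (auto simp: B_def)
    \<comment> \<open>The constant \<open>c\<close> cancels in the difference of two values.\<close>
    have "S y \<in> W" for y using W_diff[OF mem[of y] mem[of 0]] by (simp add: S.zero)
    then show ?thesis by (rule W_small)
  qed
  have "norm (S (S x)) \<le> 0"
  proof (rule field_le_epsilon)
    fix e :: real assume e: "e > 0"
    have pos: "norm x + 1 > 0" by (rule add_nonneg_pos) simp_all
    then have "e / (norm x + 1) * norm x \<le> e" using e by (simp add: pos_divide_le_eq)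
    then show "norm (S (S x)) \<le> 0 + e"
      using le[of "e / (norm x + 1)"] e pos by simp
  qed
  \<comment> \<open>By symmetry this is \<open>inner x (S (S x))\<close>.\<close>
  then have "inner (S x) (S x) = 0" by (simp add: S_sym)
  then show ?thesis by simp
qed

text \<open>For a closed affine subspace \<open>A\<close> that is invariant under \<open>H\<close>, the displacement from \<open>v\<close> to its
  projection on \<open>\<alpha> g ` A\<close> is \<open>- \<pi> g (Q (\<alpha> (- g) v - a))\<close>, where \<open>Q\<close> is the projection onto the
  orthogonal complement of the direction of \<open>A\<close> and \<open>a \<in> A\<close>. It depends on the coset of \<open>g\<close>
  only; averaging it over the cosets gives a map that intertwines \<open>\<alpha>\<close> and \<open>\<pi>\<close>.\<close>

lemma irreducible_on_subgroup:
  assumes H: "add_subgroup H" and \<nu>: "invariant_probability_on_cosets H \<nu>"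
    and irr: "irreducible_on UNIV \<alpha>"
    and integrable: "\<And>\<theta>. continuous_on UNIV \<theta> \<Longrightarrow> (\<And>g h. h \<in> H \<Longrightarrow> \<theta> (g + h) = \<theta> g) \<Longrightarrow>
      (\<exists>R. \<forall>g. 0 \<le> \<theta> g \<and> \<theta> g \<le> R + norm (b g)) \<Longrightarrow> integrable \<nu> (\<lambda>C. \<theta> (coset_rep H C) :: real)"
  shows "irreducible_on H \<alpha>"
  unfolding irreducible_on_def
proof
  assume "\<exists>A. A \<noteq> {} \<and> A \<noteq> UNIV \<and> closed A \<and> complex_affine A \<and> (\<forall>g\<in>H. \<alpha> g ` A \<subseteq> A)"
  then obtain A where A: "A \<noteq> {}" "A \<noteq> UNIV" "closed A" "complex_affine A"
    and "\<forall>h\<in>H. \<alpha> h ` A \<subseteq> A" by (elim exE conjE)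
  then have A_inv: "\<And>h. h \<in> H \<Longrightarrow> \<alpha> h ` A \<subseteq> A" by (rule_tac bspec)
  obtain a where a: "a \<in> A" using A(1) by blast
  define L where "L = (\<lambda>x. x - a) ` A"
  have L: "complex_subspace L" unfolding L_def by (rule complex_affine_translate[OF A(4) a])
  have sub: "subspace L" by (rule complex_subspace_imp_subspace[OF L])
  have "closed L" using closed_translation_subtract[OF A(3), of a] by (simp add: L_def)
  have L_iff: "x - a \<in> L \<longleftrightarrow> x \<in> A" for x by (auto simp: L_def)
  obtain Q where Q: "bounded_linear Q" "\<And>c x. Q (c *\<^sub>C x) = c *\<^sub>C Q x"
    and Q_inner: "\<And>x y. inner (Q x) y = inner (Q x) (Q y)" and Q_norm: "\<And>x. norm (Q x) \<le> norm x"
    and Q_0: "\<And>x. Q x = 0 \<longleftrightarrow> x \<in> L"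
    and Q_eqI: "\<And>x z. x - z \<in> L \<Longrightarrow> (\<And>y. y \<in> L \<Longrightarrow> inner z y = 0) \<Longrightarrow> Q x = z"
    and Q_diff_mem: "\<And>x. x - Q x \<in> L" and Q_orth: "\<And>x y. y \<in> L \<Longrightarrow> inner (Q x) y = 0"
    by (rule complement_projection_exists[OF L \<open>closed L\<close>]) blast
  interpret Q: bounded_linear Q by (rule Q(1))
  have H_minus: "- h \<in> H" if "h \<in> H" for h using H that by (simp add: add_subgroup_def)
  have L_inv: "\<pi> h x \<in> L" if h: "h \<in> H" and x: "x \<in> L" for h x
  proof -
    have "x + a \<in> A" using x by (auto simp: L_def)
    then have "\<alpha> h (x + a) - a \<in> L" "\<alpha> h a - a \<in> L" using A_inv[OF h] a by (auto simp: L_iff)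
    then have "(\<alpha> h (x + a) - a) - (\<alpha> h a - a) \<in> L" by (rule subspace_diff[OF sub])
    then show ?thesis using action_diff[of h "x + a" a] by simp
  qed
  have Q_rep: "Q (\<pi> h x) = \<pi> h (Q x)" if h: "h \<in> H" for h x
  proof (rule Q_eqI)
    show "\<pi> h x - \<pi> h (Q x) \<in> L" unfolding rep_diff[symmetric] by (rule L_inv[OF h Q_diff_mem])
    show "inner (\<pi> h (Q x)) y = 0" if "y \<in> L" for y
      unfolding rep_inner_left by (rule Q_orth[OF L_inv[OF H_minus[OF h] that]])
  qed

  \<comment> \<open>\<open>T g\<close> is the projection onto the orthogonal complement of the image
    of \<open>L\<close> under \<open>\<pi> g\<close>, and \<open>d g\<close> is an affine map with
    linear part \<open>T g\<close>. The sign is opposite to that of the displacement, so the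
    constant called \<open>c\<close> becomes \<open>- D 0\<close>.\<close>
  define T where "T g x = \<pi> g (Q (\<pi> (- g) x))" for g x
  define d where "d g v = \<pi> g (Q (\<alpha> (- g) v - a))" for g v
  have d_eq: "d g v = T g v + d g 0" for g v
    by (simp add: d_def T_def action Q.add Q.diff rep_add rep_diff rep_0)
  have T_coset: "T (g + h) x = T g x" if "h \<in> H" for g h x
    by (simp add: T_def minus_add rep_compose Q_rep[OF H_minus[OF that]] del: add_uminus_conv_diff)
  have d_coset: "d (g + h) v = d g v" if h: "h \<in> H" for g h v
  proof -
    have "\<alpha> (- h) a \<in> A" using A_inv[OF H_minus[OF h]] a by blast
    then have 0: "Q (\<alpha> (- h) a - a) = 0" by (simp add: Q_0 L_iff)
    have "\<alpha> (- (g + h)) v - a = \<pi> (- h) (\<alpha> (- g) v - a) + (\<alpha> (- h) a - a)"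
      by (simp add: minus_add action_compose action_diff[symmetric] del: add_uminus_conv_diff)
    then have "Q (\<alpha> (- (g + h)) v - a) = \<pi> (- h) (Q (\<alpha> (- g) v - a))"
      by (simp only: Q.add 0 Q_rep[OF H_minus[OF h]] add_0_right)
    then show ?thesis by (simp add: d_def rep_compose)
  qed
  have d_equi: "d g (\<alpha> k v) = \<pi> k (d (- k + g) v)" for g k v
    by (simp add: d_def rep_compose[symmetric] action_compose[symmetric] minus_add del: add_uminus_conv_diff)
  \<comment> \<open>Up to a constant the displacement grows no faster than \<open>b\<close>; this is
    the domination that the integrability hypothesis demands.\<close>
  have d_norm: "norm (d g v) \<le> (norm v + norm a) + norm (b g)" for g v
  proof -
    have "norm (d g v) \<le> norm (\<pi> (- g) v + b (- g) - a)" unfolding d_def action rep_norm by (rule Q_norm)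
    also have "\<dots> \<le> norm (\<pi> (- g) v + b (- g)) + norm a" by (rule norm_triangle_ineq4)
    also have "\<dots> \<le> norm (\<pi> (- g) v) + norm (b (- g)) + norm a" 
      by (rule add_right_mono[OF norm_triangle_ineq])
    finally show ?thesis by (simp add: norm_cocycle_minus)
  qed
  have cont_minus: "continuous_on UNIV (\<lambda>g. x (- g))" if "continuous_on UNIV x" for x :: "'g \<Rightarrow> 'h"
    using continuous_on_compose2[OF that, of UNIV uminus] by (simp add: continuous_on_minus)
  have d_cont: "continuous_on UNIV (\<lambda>g. d g v)" for v
  proof -
    have "continuous_on UNIV (\<lambda>g. \<pi> g v + b g)"
      using cocycle by (intro continuous_intros continuous_on_rep) (simp add: continuous_cocycle_def)
    then have "continuous_on UNIV (\<lambda>g. \<alpha> (- g) v)"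
      using cont_minus[of "\<lambda>g. \<pi> g v + b g"] by (simp add: action)
    then show ?thesis
      unfolding d_def by (intro continuous_on_rep Q.continuous_on continuous_intros)
  qed

  have prob: "emeasure \<nu> (space \<nu>) = 1" using \<nu> by (simp add: invariant_probability_on_cosets_def)
  interpret \<nu>: finite_measure \<nu> by (rule finite_measureI) (simp add: prob)
  define r where "r = coset_rep H"
  have norm_int: "integrable \<nu> (\<lambda>C. norm (d (r C) v))" for v
    unfolding r_def
  proof (rule integrable)
    show "continuous_on UNIV (\<lambda>g. norm (d g v))" by (intro continuous_intros d_cont)
    show "norm (d (g + h) v) = norm (d g v)" if "h \<in> H" for g h by (simp add: d_coset[OF that])
    show "\<exists>R. \<forall>g. 0 \<le> norm (d g v) \<and> norm (d g v) \<le> R + norm (b g)" using d_norm by auto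
  qed
  have inner_meas: "(\<lambda>C. inner y (d (r C) v)) \<in> borel_measurable \<nu>" for y v
    unfolding r_def
    by (rule coset_rep_measurable[OF H \<nu>]) (simp_all add: d_coset continuous_on_inner d_cont)
  have inner_int: "integrable \<nu> (\<lambda>C. inner y (d (r C) v))" for y v
    using integrable_mult_right[OF norm_int[of v], of "norm y"] inner_meas
    by (rule Bochner_Integration.integrable_bound) (simp add: Cauchy_Schwarz_ineq2)
  \<comment> \<open>The average of the vectors \<open>d (r C) v\<close> is defined through its inner
    products, so only real functions are integrated.\<close>
  have "\<exists>z. \<forall>y. (\<integral>C. inner y (d (r C) v) \<partial>\<nu>) = inner y z" for v
  proof (intro Riesz_representation_exists bounded_linear_intro)
    show "(\<integral>C. inner (x + y) (d (r C) v) \<partial>\<nu>)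
        = (\<integral>C. inner x (d (r C) v) \<partial>\<nu>) + (\<integral>C. inner y (d (r C) v) \<partial>\<nu>)" for x y
      by (simp add: inner_add_left inner_int)
    show "(\<integral>C. inner (s *\<^sub>R x) (d (r C) v) \<partial>\<nu>) = s *\<^sub>R (\<integral>C. inner x (d (r C) v) \<partial>\<nu>)" for s x
      by simp
    show "norm (\<integral>C. inner x (d (r C) v) \<partial>\<nu>) \<le> norm x * (\<integral>C. norm (d (r C) v) \<partial>\<nu>)" for x
    proof -
      have "norm (\<integral>C. inner x (d (r C) v) \<partial>\<nu>) \<le> (\<integral>C. norm (inner x (d (r C) v)) \<partial>\<nu>)"
        by (rule integral_norm_bound)
      also have "\<dots> \<le> (\<integral>C. norm x * norm (d (r C) v) \<partial>\<nu>)"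
        by (intro integral_mono integrable_norm inner_int integrable_mult_right norm_int)
          (simp add: Cauchy_Schwarz_ineq2)
      finally have "norm (\<integral>C. inner x (d (r C) v) \<partial>\<nu>) \<le> (\<integral>C. norm x * norm (d (r C) v) \<partial>\<nu>)" .
      then show ?thesis by simp
    qed
  qed
  then obtain D where D: "\<And>v y. inner y (D v) = (\<integral>C. inner y (d (r C) v) \<partial>\<nu>)" by metis
  \<comment> \<open>Acting by \<open>k\<close> shifts the coset by \<open>- k\<close>, and
    invariance of \<nu> removes the shift.\<close>
  have D_equi: "D (\<alpha> k v) = \<pi> k (D v)" for k v
  proof (rule inner_eq_all_imp_eq)
    fix y
    have "inner y (D (\<alpha> k v)) = (\<integral>C. inner (\<pi> (- k) y) (d (- k + r C) v) \<partial>\<nu>)"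
      unfolding D d_equi by (simp add: rep_inner_left)
    also have "\<dots> = (\<integral>C. inner (\<pi> (- k) y) (d (r C) v) \<partial>\<nu>)"
      unfolding r_def
      by (rule integral_coset_translate[OF H \<nu>, where F = "\<lambda>g. inner (\<pi> (- k) y) (d g v)"])
        (simp_all add: d_coset continuous_on_inner d_cont)
    also have "\<dots> = inner (\<pi> (- k) y) (D v)" by (rule D[symmetric])
    also have "\<dots> = inner y (\<pi> k (D v))" by (simp add: rep_inner_left)
    finally show "inner y (D (\<alpha> k v)) = inner y (\<pi> k (D v))" .
  qed

  define S where "S v = D v - D 0" for v
  have T_d: "inner y (T g v) = inner y (d g v) - inner y (d g 0)" for y g v
    by (simp add: d_eq[of g v] inner_add_right)
  have T_int: "integrable \<nu> (\<lambda>C. inner y (T (r C) v))" for y v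
    unfolding T_d by (intro Bochner_Integration.integrable_diff inner_int)
  have S: "inner y (S v) = (\<integral>C. inner y (T (r C) v) \<partial>\<nu>)" for y v
    unfolding T_d S_def inner_diff_right D by (simp add: inner_int)
  have T_add: "T g (x + y) = T g x + T g y" for g x y by (simp add: T_def rep_add Q.add)
  have T_scaleC: "T g (c *\<^sub>C x) = c *\<^sub>C T g x" for g c x by (simp add: T_def rep_scaleC Q(2))
  \<comment> \<open>The formula is symmetric in \<open>x\<close> and \<open>y\<close> and
    non-negative for \<open>x = y\<close>; both properties pass to the average
    \<open>S\<close>.\<close>
  have T_inner: "inner x (T g y) = inner (Q (\<pi> (- g) x)) (Q (\<pi> (- g) y))" for g x y
    unfolding T_def by (metis Q_inner inner_commute rep_inner_left)
  have T_norm: "norm (T g x) \<le> norm x" for g x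
    using Q_norm[of "\<pi> (- g) x"] by (simp add: T_def)
  have S_inner_self: "inner x (S x) = (\<integral>C. (norm (Q (\<pi> (- r C) x)))\<^sup>2 \<partial>\<nu>)" for x
    unfolding S T_inner by (simp add: power2_norm_eq_inner)
  have S_add: "S (x + y) = S x + S y" for x y
    by (rule inner_eq_all_imp_eq) (simp add: S T_add inner_add_right T_int)
  have S_scaleC: "S (c *\<^sub>C x) = c *\<^sub>C S x" for c x
  proof (rule inner_eq_all_imp_eq)
    fix y :: 'h
    \<comment> \<open>Real integrals cannot absorb a complex factor, so it is moved to the test
      vector.\<close>
    have eq: "inner y (c *\<^sub>C z) = inner (cnj c *\<^sub>C y) z" for z by (simp add: inner_scaleC_left)
    show "inner y (S (c *\<^sub>C x)) = inner y (c *\<^sub>C S x)" by (simp only: eq S T_scaleC)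
  qed
  have inner_S_le: "inner y (S x) \<le> norm y * norm x" for x y
  proof -
    have "(\<integral>C. inner y (T (r C) x) \<partial>\<nu>) \<le> (\<integral>C. norm y * norm x \<partial>\<nu>)"
    proof (rule integral_mono[OF T_int \<nu>.integrable_const])
      fix C
      have "inner y (T (r C) x) \<le> norm y * norm (T (r C) x)" by (rule norm_cauchy_schwarz)
      also have "\<dots> \<le> norm y * norm x" by (rule mult_left_mono[OF T_norm]) simp
      finally show "inner y (T (r C) x) \<le> norm y * norm x" .
    qed
    also have "\<dots> = norm y * norm x" using prob by (simp add: measure_def)
    finally have "(\<integral>C. inner y (T (r C) x) \<partial>\<nu>) \<le> norm y * norm x" .
    then show ?thesis by (simp add: S)
  qed
  have S_norm: "norm (S x) \<le> norm x" for x
  proof -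
    have "norm (S x) * norm (S x) \<le> norm (S x) * norm x"
      using inner_S_le[of "S x" x] by (simp add: power2_norm_eq_inner[symmetric] power2_eq_square)
    then show ?thesis by (cases "S x = 0") simp_all
  qed
  have S_contr: "positive_contraction S"
  proof (rule positive_contraction.intro)
    show "bounded_linear S"
      by (rule bounded_linear_intro[where K = 1]) (simp_all add: S_add S_scaleC scaleR_scaleC S_norm)
    show "inner (S x) y = inner x (S y)" for x y
      unfolding inner_commute[of "S x"] S T_inner by (simp add: inner_commute)
    show "0 \<le> inner (S x) x" for x
      unfolding inner_commute[of "S x"] S_inner_self by simp
    show "inner (S x) x \<le> (norm x)\<^sup>2" for x
      using inner_S_le[of x x] by (simp add: inner_commute power2_eq_square)
  qed (rule S_scaleC)
  have equi: "S (\<alpha> g v) - (- D 0) = \<pi> g (S v - (- D 0))" for g v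
    by (simp add: S_def D_equi)
  have S_rep: "S (\<pi> g x) = \<pi> g (S x)" for g x
  proof -
    interpret S: bounded_linear S using S_contr by (rule positive_contraction.bounded_linear_S)
    have "S (\<pi> g x) = S (\<alpha> g x) - S (\<alpha> g 0)"
      unfolding S.diff[symmetric] action_diff by simp
    also have "\<dots> = (S (\<alpha> g x) - (- D 0)) - (S (\<alpha> g 0) - (- D 0))" by simp
    also have "\<dots> = \<pi> g (S x - (- D 0)) - \<pi> g (S 0 - (- D 0))" by (simp only: equi)
    finally show ?thesis by (simp add: rep_diff[symmetric] S.zero)
  qed
  have S_zero: "S x = 0" for x
    by (rule irreducible_imp_equivariant_trivial[OF irr S_contr S_rep equi])
  have "Q x = 0" for x
  proof (rule ccontr)
    assume Qx: "Q x \<noteq> 0"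
    \<comment> \<open>\<open>F g\<close> is the squared norm of \<open>Q (\<pi> (- g) x)\<close>. It
      is continuous with average 0, so full support makes it vanish everywhere, whereas
      \<open>F 0\<close> is the squared norm of \<open>Q x\<close>.\<close>
    define F where "F g = inner x (T g x)" for g
    have F_nonneg: "0 \<le> F g" for g by (simp add: F_def T_inner)
    have F_cont: "continuous_on UNIV F"
      unfolding F_def T_d by (intro continuous_intros d_cont)
    have F_coset: "F (g + h) = F g" if "h \<in> H" for g h by (simp add: F_def T_coset[OF that])
    have inv: "F (r (left_coset H g)) = F g" for g
      unfolding r_def by (rule coset_rep_invariant[OF H]) (rule F_coset)
    define U where "U = {g. F g \<noteq> 0}"
    have U: "open U" unfolding U_def by (intro open_Collect_neq F_cont continuous_on_const)
    have "F 0 \<noteq> 0" using Qx by (simp add: F_def T_inner)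
    then have "U \<noteq> {}" by (auto simp: U_def)
    have "(\<integral>C. F (r C) \<partial>\<nu>) = 0" using S[of x x] S_zero by (simp add: F_def)
    then have "AE C in \<nu>. F (r C) = 0"
      using integral_nonneg_eq_0_iff_AE[of \<nu> "\<lambda>C. F (r C)"] T_int[of x x] F_nonneg by (simp add: F_def)
    then have "AE C in \<nu>. C \<notin> left_coset H ` U"
      by (rule AE_mp) (intro AE_I2, use inv in \<open>auto simp: U_def\<close>)
    then have "emeasure \<nu> (left_coset H ` U) = 0"
      using left_coset_image_in_sets[OF \<nu> H U] sets.sets_into_space[OF left_coset_image_in_sets[OF \<nu> H U]]
      by (subst (asm) AE_iff_measurable[OF _ refl]) (auto simp: Int_absorb1 Int_def[symmetric])
    then show False using emeasure_coset_open_pos[OF H \<nu> U \<open>U \<noteq> {}\<close>] by blast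
  qed
  then have "x - a \<in> L" for x using Q_0 by blast
  then have "A = UNIV" by (auto simp: L_iff)
  then show False using A(2) by blast
qed

end

section \<open>Integrability under the two hypotheses\<close>

lemma integrable_coset_rep_cocompact:
  fixes H :: "'g::{topological_group_add, t2_space} set" and \<theta> :: "'g \<Rightarrow> real"
  assumes lc: "locally_compact_space (euclidean :: 'g topology)" and H: "add_subgroup H"
    and \<nu>: "invariant_probability_on_cosets H \<nu>" and cpt: "compact_space (coset_topology H)"
    and \<theta>: "continuous_on UNIV \<theta>" "\<And>g h. h \<in> H \<Longrightarrow> \<theta> (g + h) = \<theta> g"
  shows "integrable \<nu> (\<lambda>C. \<theta> (coset_rep H C))"
proof -
  have inv: "\<theta> (coset_rep H (left_coset H g)) = \<theta> g" for g
    by (rule coset_rep_invariant[OF H]) (rule \<theta>(2))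
  have "compactin (coset_topology H) (range (left_coset H))"
    using cpt by (simp add: compact_space_def topspace_coset_topology)
  \<comment> \<open>The compact set \<open>K\<close> meets every coset, so \<theta> takes all its
    values on \<open>K\<close> and is bounded.\<close>
  from compactin_coset_lift[OF lc H open_UNIV this] obtain K
    where K: "compact K" "range (left_coset H) \<subseteq> left_coset H ` K" by auto
  have "bounded (\<theta> ` K)"
    by (intro compact_imp_bounded compact_continuous_image K continuous_on_subset[OF \<theta>(1)]) simp
  then obtain B where B: "\<And>k. k \<in> K \<Longrightarrow> norm (\<theta> k) \<le> B" unfolding bounded_iff by blast
  interpret finite_measure \<nu>
    using \<nu> by (intro finite_measureI) (simp add: invariant_probability_on_cosets_def)
  show ?thesis
  proof (rule integrable_const_bound[of _ B])
    show "(\<lambda>C. \<theta> (coset_rep H C)) \<in> borel_measurable \<nu>"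
      by (rule coset_rep_measurable[OF H \<nu>]) (rule \<theta>, assumption, rule \<theta>)
    show "AE C in \<nu>. norm (\<theta> (coset_rep H C)) \<le> B"
    proof (rule AE_I2)
      fix C assume "C \<in> space \<nu>"
      then obtain k where "k \<in> K" "C = left_coset H k"
        using K(2) unfolding space_invariant_probability[OF \<nu>] by blast
      then show "norm (\<theta> (coset_rep H C)) \<le> B" using B by (simp add: inv)
    qed
  qed
qed

lemma integrable_coset_rep_discrete:
  fixes H :: "'g::{topological_group_add, t2_space} set" and \<theta> :: "'g \<Rightarrow> real"
    and b :: "'g \<Rightarrow> 'h::real_normed_vector"
  assumes lc: "locally_compact_space (euclidean :: 'g topology)"
    and H: "add_subgroup H" "closed H" "discrete H"
    and \<nu>: "invariant_probability_on_cosets H \<nu>" and b: "integrable_on_cosets H b"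
    and \<theta>: "continuous_on UNIV \<theta>" "\<And>g h. h \<in> H \<Longrightarrow> \<theta> (g + h) = \<theta> g"
    and le: "\<And>g. 0 \<le> \<theta> g" "\<And>g. \<theta> g \<le> R + norm (b g)"
  shows "integrable \<nu> (\<lambda>C. \<theta> (coset_rep H C))"
proof -
  obtain \<mu> \<Omega> where \<mu>: "haar_measure \<mu>" and \<Omega>: "fundamental_domain H \<Omega>"
    and fin: "(\<integral>\<^sup>+ x\<in>\<Omega>. ennreal (norm (b x)) \<partial>\<mu>) < \<infinity>"
    using b unfolding integrable_on_cosets_def by blast
  obtain C where C: "C < (\<infinity>::ennreal)" and C_le: "\<And>f. f \<in> borel_measurable \<nu> \<Longrightarrow>
       (\<integral>\<^sup>+ y. f y \<partial>\<nu>) \<le> C * (\<integral>\<^sup>+ x\<in>\<Omega>. f (left_coset H x) \<partial>\<mu>)"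
    by (rule nn_integral_coset_le_fundamental_domain[OF lc H \<mu> \<nu> \<Omega>]) blast
  have inv: "\<theta> (coset_rep H (left_coset H g)) = \<theta> g" for g
    by (rule coset_rep_invariant[OF H(1)]) (rule \<theta>(2))
  have \<theta>_meas [measurable]: "(\<lambda>C. \<theta> (coset_rep H C)) \<in> borel_measurable \<nu>"
    by (rule coset_rep_measurable[OF H(1) \<nu>]) (rule \<theta>, assumption, rule \<theta>)
  \<comment> \<open>The constant \<open>R\<close> is removed before passing to \<Omega>, whose Haar
    measure is not known to be finite, and restored on the side of the probability measure \<nu>. It
    returns as \<open>\<bar>R\<bar>\<close> because \<open>R\<close> may be negative.\<close>
  define f where "f C = max 0 (\<theta> (coset_rep H C) - R)" for C
  have f_meas [measurable]: "f \<in> borel_measurable \<nu>" unfolding f_def by measurable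
  have "(\<integral>\<^sup>+ y. ennreal (f y) \<partial>\<nu>) \<le> C * (\<integral>\<^sup>+ x\<in>\<Omega>. ennreal (f (left_coset H x)) \<partial>\<mu>)"
    by (rule C_le) measurable
  also have "\<dots> \<le> C * (\<integral>\<^sup>+ x\<in>\<Omega>. ennreal (norm (b x)) \<partial>\<mu>)"
  proof (intro mult_left_mono nn_integral_mono mult_right_mono ennreal_leI)
    show "f (left_coset H x) \<le> norm (b x)" for x using le(2)[of x] by (simp add: f_def inv)
  qed simp_all
  also have "\<dots> < \<infinity>" using C fin by (simp add: ennreal_mult_less_top)
  finally have "integrable \<nu> f"
    by (intro integrableI_nonneg f_meas) (simp_all add: f_def)
  interpret finite_measure \<nu>
    using \<nu> by (intro finite_measureI) (simp add: invariant_probability_on_cosets_def)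
  have "integrable \<nu> (\<lambda>C. \<bar>R\<bar> + f C)"
    using \<open>integrable \<nu> f\<close> by simp
  then show ?thesis
  proof (rule Bochner_Integration.integrable_bound[OF _ \<theta>_meas])
    show "AE C in \<nu>. norm (\<theta> (coset_rep H C)) \<le> norm (\<bar>R\<bar> + f C)"
      using le(1) by (intro AE_I2) (auto simp: f_def)
  qed
qed

theorem theorem4p1:
  fixes H :: "'g::{topological_group_add, t2_space} set"
    and \<pi> :: "'g \<Rightarrow> 'h::complex_hilbert_space \<Rightarrow> 'h"
    and b :: "'g \<Rightarrow> 'h"
    and \<alpha> :: "'g \<Rightarrow> 'h \<Rightarrow> 'h"
  assumes "locally_compact_space (euclidean :: 'g topology)"
    and "add_subgroup H" and "closed H"
    and "\<exists>\<nu>. invariant_probability_on_cosets H \<nu>"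
    and "continuous_unitary_rep \<pi>" and "continuous_cocycle \<pi> b"
    and "\<And>g v. \<alpha> g v = \<pi> g v + b g"
    and "compact_space (coset_topology H) \<or> (discrete H \<and> integrable_on_cosets H b)"
    and "irreducible_on UNIV \<alpha>"
  shows "irreducible_on H \<alpha>"
proof -
  interpret affine_isometric_action \<pi> b \<alpha> by standard (rule assms)+
  obtain \<nu> where \<nu>: "invariant_probability_on_cosets H \<nu>" using assms(4) by blast
  show ?thesis
  proof (rule irreducible_on_subgroup[OF assms(2) \<nu> assms(9)])
    fix \<theta> :: "'g \<Rightarrow> real"
    assume \<theta>: "continuous_on UNIV \<theta>" "\<And>g h. h \<in> H \<Longrightarrow> \<theta> (g + h) = \<theta> g"
    assume "\<exists>R. \<forall>g. 0 \<le> \<theta> g \<and> \<theta> g \<le> R + norm (b g)"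
    then obtain R where R: "\<And>g. 0 \<le> \<theta> g" "\<And>g. \<theta> g \<le> R + norm (b g)" by blast
    show "integrable \<nu> (\<lambda>C. \<theta> (coset_rep H C))"
      using assms(8)
    proof (elim disjE conjE)
      assume "compact_space (coset_topology H)"
      from integrable_coset_rep_cocompact[OF assms(1,2) \<nu> this \<theta>] show ?thesis .
    next
      assume "discrete H" "integrable_on_cosets H b"
      from integrable_coset_rep_discrete[OF assms(1-3) this(1) \<nu> this(2) \<theta> R] show ?thesis .
    qed
  qed
qed

end
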